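(* Let $f:\mathbb{R}\to\mathbb{R}$ be Riemann's function $f(x)=\sum_{n=1}^{\infty}\frac{\sin(n^{2}\pi x)}{n^{2}}$. Suppose $r=p/q$ is a rational number, where $p,q$ are integers with $q\ge1$ and $(p,q)=1$. If $p$ and $q$ are both odd, then $f$ is differentiable at $r$ and its pointwise Hölder exponent at $r$ is $3/2$; otherwise the pointwise Hölder exponent of $f$ at $r$ equals $1/2$.
   Context: Hölder exponent: for a function $F$ on $\mathbb{R}$ and $x\in\mathbb{R}$, the pointwise Hölder exponent of $F$ at $x$ is the supremum of all $\alpha>0$ for which there is a polynomial $P_x$ such that $F(x+h)=P_x(h)+O_x(|h|^{\alpha})$ as $h\to0$, $h\in\mathbb{R}$. *)

theory Defs
  imports "HOL-Analysis.Analysis" "HOL-Library.Landau_Symbols"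
    "HOL-Computational_Algebra.Polynomial"
begin

definition riemann_fun :: "real \<Rightarrow> real" where
  "riemann_fun x = (\<Sum>n. sin (real (Suc n) ^ 2 * pi * x) / real (Suc n) ^ 2)"

text \<open>
  The filter is \<^term>\<open>nhds 0\<close> rather than \<^term>\<open>at 0\<close>: the bound is required for all sufficiently
  small \<open>h\<close>, including \<open>h = 0\<close>, where it forces \<open>P(0) = F(x)\<close> (note \<open>0 powr \<alpha> = 0\<close>). For functions
  continuous at \<open>x\<close> the two filters give the same notion.
\<close>
definition holder_at :: "(real \<Rightarrow> real) \<Rightarrow> real \<Rightarrow> real \<Rightarrow> bool" where
  "holder_at F x \<alpha> \<longleftrightarrow>
     (\<exists>P :: real poly. (\<lambda>h. F (x + h) - poly P h) \<in> O[nhds 0](\<lambda>h. \<bar>h\<bar> powr \<alpha>))"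

text \<open>
  The supremum is taken in \<open>[0, \<infinity>]\<close>: it is \<open>\<infinity>\<close> if all exponents are admissible (for instance for
  smooth functions) and \<open>0\<close> if none is.
\<close>
definition holder_exponent :: "(real \<Rightarrow> real) \<Rightarrow> real \<Rightarrow> ennreal" where
  "holder_exponent F x = Sup {ennreal \<alpha> | \<alpha>. \<alpha> > 0 \<and> holder_at F x \<alpha>}"

end

theory Submission
  imports Defs "HOL-Complex_Analysis.Complex_Analysis" "HOL-Probability.Characteristic_Functions"
begin

text \<open>
Write \<open>e(t) = exp (\<i> \<pi> t)\<close>. Riemann's function is the imaginary part of the boundary values of a
function that is holomorphic in a half plane and whose derivative is a theta series. Near a rational point
the reciprocity formula for theta series describes this derivative completely, and integrating it gives
an asymptotic expansion from which both Hoelder exponents can be read off.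

In detail, let \<open>S\<^sub>j(b, w)\<close> be the sum over \<open>n \<ge> 1\<close> of \<open>b\<^sub>n (\<pi> n\<^sup>2)\<^sup>-\<^sup>j exp (- \<pi> n\<^sup>2 w)\<close>
(\<open>square_series\<close>), so that \<open>S\<^sub>j\<^sub>+\<^sub>1\<close> has derivative \<open>- S\<^sub>j\<close> for \<open>Re w > 0\<close>. With \<open>r = p / q\<close>,
\<open>N = 2 q\<close> and \<open>c\<^sub>n = e(n\<^sup>2 r)\<close>, which is even and has period \<open>N\<close> in \<open>n\<close>, one has
\<open>f(r + h) = \<pi> Im S\<^sub>1(c, - \<i> h)\<close>. Let \<open>d\<close> be the discrete Fourier transform of \<open>c\<close>. Poisson summation for
Gaussians, applied in every residue class modulo \<open>N\<close> and continued analytically from the positive reals,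
gives \<open>c\<^sub>0 + 2 S\<^sub>0(c, z) = (d\<^sub>0 + 2 S\<^sub>0(d, 1 / (N\<^sup>2 z))) / (N \<surd>z)\<close> (\<open>theta_reciprocity\<close>). Since
\<open>S\<^sub>0(d, 1 / (N\<^sup>2 z))\<close> oscillates rapidly as \<open>z\<close> approaches \<open>0\<close>, each integration by parts gains a factor
\<open>z\<close>, and two of them yield, on the closed half plane,
\<open>S\<^sub>1(c, z) = S\<^sub>1(c, 0) + c\<^sub>0 z / 2 - (d\<^sub>0 / N) \<surd>z - N z \<surd>z S\<^sub>1(d, 1 / (N\<^sup>2 z)) + O(|z|\<^sup>2 \<surd>|z|)\<close>
(\<open>norm_remainder_le\<close>, where a multiple of \<open>z\<^sup>2 \<surd>z S\<^sub>2(d, 1 / (N\<^sup>2 z))\<close> is split off from the error term).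

The coefficient \<open>d\<^sub>0\<close> of the square root is a quadratic Gauss sum, and expanding \<open>|d\<^sub>0|\<^sup>2\<close> gives
\<open>2 q (1 + e(p q))\<close>; so \<open>d\<^sub>0\<close> vanishes exactly when \<open>p\<close> and \<open>q\<close> are both odd.

If \<open>d\<^sub>0\<close> is not zero, the increment of \<open>f\<close> at \<open>r\<close> has size \<open>\<surd>|h|\<close> on at least one side: the values of
\<open>\<surd>(- \<i> h)\<close> on the two sides are independent over the reals, so the imaginary parts of their products
with \<open>d\<^sub>0\<close> cannot both vanish. The exponent is \<open>1/2\<close>.

If \<open>d\<^sub>0 = 0\<close>, then \<open>f\<close> has derivative \<open>- \<pi> / 2\<close> at \<open>r\<close>, up to an error \<open>O(|h| \<surd>|h|)\<close>. The next term is, for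
\<open>h > 0\<close>, \<open>h \<surd>h\<close> times a periodic function of \<open>1 / h\<close>. An exponent above \<open>3/2\<close> would force this
periodic function to tend to \<open>0\<close>, hence to vanish. But it is the imaginary part of a series whose
frequencies all have the same sign, so all coefficients \<open>d\<^sub>k\<close> with \<open>k \<ge> 1\<close> would vanish, against
\<open>d\<^sub>0 + \<dots> + d\<^sub>N\<^sub>-\<^sub>1 = N c\<^sub>0 = N\<close>. The exponent is \<open>3/2\<close>.
\<close>

section \<open>Fourier series of a function at a point of differentiability\<close>

lemma has_integral_cis_period:
  fixes j :: int
  shows "((\<lambda>x. cis (2 * pi * of_int j * x)) has_integral (if j = 0 then 1 else 0)) {-1/2..1/2::real}"
proof (cases "j = 0")
  case True
  then show ?thesis
    using has_integral_const_real[of "1::complex" "-1/2" "1/2"] by simp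
next
  case False
  define c where "c = 2 * pi * of_int j"
  have c: "c \<noteq> 0" using False by (simp add: c_def)
  define G where "G = (\<lambda>x::real. cis (c * x) / (\<i> * of_real c))"
  have "((\<lambda>x. cis (c * x)) has_integral (G (1/2) - G (-1/2))) {-1/2..1/2::real}"
  proof (rule fundamental_theorem_of_calculus)
    fix x :: real
    have "((\<lambda>z. exp (\<i> * of_real c * z) / (\<i> * of_real c)) has_field_derivative exp (\<i> * of_real c * of_real x))
            (at (of_real x))"
      using c by (auto intro!: derivative_eq_intros)
    then show "(G has_vector_derivative cis (c * x)) (at x within {-1/2..1/2})"
      unfolding G_def cis_conv_exp
      by (auto dest!: has_vector_derivative_real_field simp: mult_ac)
  qed simp
  moreover have "cis (c * (1/2)) = cis (c * (-1/2))"
  proof -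
    have "cis (c * (1/2)) = cis (c * (-1/2) + 2 * pi * of_int j)"
      by (rule arg_cong[of _ _ cis]) (simp add: c_def)
    also have "\<dots> = cis (c * (-1/2))"
      by (metis cis_mult cis_multiple_2pi mult.right_neutral Ints_of_int)
    finally show ?thesis .
  qed
  ultimately show ?thesis
    using False by (simp add: G_def c_def)
qed

text \<open>
The period is centred at \<open>0\<close>, so that the only zero of \<open>exp (2 \<pi> \<i> x) - 1\<close> in it is the interior point \<open>0\<close>.
\<close>

definition fourier_coeff :: "(real \<Rightarrow> complex) \<Rightarrow> int \<Rightarrow> complex" where
  "fourier_coeff g j = integral {-1/2..1/2} (\<lambda>x. g x * cis (- (2 * pi * of_int j * x)))"

lemma has_integral_fourier_coeff:
  assumes "continuous_on {-1/2..1/2} g"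
  shows "((\<lambda>x. g x * cis (- (2 * pi * of_int j * x))) has_integral fourier_coeff g j) {-1/2..1/2}"
  unfolding fourier_coeff_def
  by (intro integrable_integral integrable_continuous_interval continuous_intros assms)

text \<open>
By orthonormality the difference of the two sides is the integral of \<open>|g - s|\<^sup>2\<close>, where \<open>s\<close> is the partial
Fourier sum of \<open>g\<close> over \<open>F\<close>.
\<close>

lemma bessel_inequality:
  assumes g: "continuous_on {-1/2..1/2} g" and F: "finite F"
  shows "(\<Sum>j\<in>F. (cmod (fourier_coeff g j))\<^sup>2) \<le> integral {-1/2..1/2} (\<lambda>x. (cmod (g x))\<^sup>2)"
proof -
  define c where "c = fourier_coeff g"
  define s where "s = (\<lambda>x. \<Sum>j\<in>F. c j * cis (2 * pi * of_int j * x))"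
  define S where "S = (\<Sum>j\<in>F. (cmod (c j))\<^sup>2)"
  define I where "I = integral {-1/2..1/2} (\<lambda>x. (cmod (g x))\<^sup>2)"
  have I1: "((\<lambda>x. of_real ((cmod (g x))\<^sup>2)) has_integral (of_real I :: complex)) {-1/2..1/2}"
    unfolding I_def
    by (intro has_integral_of_real integrable_integral integrable_continuous_interval continuous_intros g)
  have I2: "((\<lambda>x. g x * cnj (s x)) has_integral of_real S) {-1/2..1/2}"
  proof -
    have "((\<lambda>x. \<Sum>j\<in>F. cnj (c j) * (g x * cis (- (2 * pi * of_int j * x)))) has_integral
            (\<Sum>j\<in>F. cnj (c j) * c j)) {-1/2..1/2}"
      unfolding c_def by (intro has_integral_sum F has_integral_mult_right has_integral_fourier_coeff g)
    also have "(\<lambda>x. \<Sum>j\<in>F. cnj (c j) * (g x * cis (- (2 * pi * of_int j * x)))) = (\<lambda>x. g x * cnj (s x))"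
      by (simp add: s_def sum_distrib_left cis_cnj mult_ac)
    also have "(\<Sum>j\<in>F. cnj (c j) * c j) = of_real S"
      by (simp add: S_def complex_norm_square mult.commute del: of_real_power)
    finally show ?thesis .
  qed
  have I3: "((\<lambda>x. cnj (g x) * s x) has_integral of_real S) {-1/2..1/2}"
    using has_integral_cnj[of "\<lambda>x. g x * cnj (s x)" "of_real S" "{-1/2..1/2}"] I2 by (simp add: o_def)
  have I4: "((\<lambda>x. s x * cnj (s x)) has_integral of_real S) {-1/2..1/2}"
  proof -
    have "((\<lambda>x. \<Sum>i\<in>F. \<Sum>j\<in>F. c i * cnj (c j) * cis (2 * pi * of_int (i - j) * x)) has_integral
            (\<Sum>i\<in>F. \<Sum>j\<in>F. c i * cnj (c j) * (if i - j = 0 then 1 else 0))) {-1/2..1/2}"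
      by (intro has_integral_sum F has_integral_mult_right has_integral_cis_period)
    also have "(\<lambda>x. \<Sum>i\<in>F. \<Sum>j\<in>F. c i * cnj (c j) * cis (2 * pi * of_int (i - j) * x)) = (\<lambda>x. s x * cnj (s x))"
    proof
      fix x :: real
      have "cis (2 * pi * of_int (i - j) * x) = cis (2 * pi * of_int i * x) * cis (- (2 * pi * of_int j * x))" for i j
        by (simp add: cis_mult algebra_simps)
      then show "(\<Sum>i\<in>F. \<Sum>j\<in>F. c i * cnj (c j) * cis (2 * pi * of_int (i - j) * x)) = s x * cnj (s x)"
        by (simp add: s_def sum_product cis_cnj mult_ac)
    qed
    also have "(\<Sum>i\<in>F. \<Sum>j\<in>F. c i * cnj (c j) * (if i - j = 0 then 1 else 0)) = (\<Sum>i\<in>F. c i * cnj (c i))"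
      by (intro sum.cong refl) (simp add: F if_distrib cong: if_cong)
    also have "\<dots> = of_real S"
      by (simp add: S_def complex_norm_square del: of_real_power)
    finally show ?thesis .
  qed
  have "((\<lambda>x. of_real ((cmod (g x))\<^sup>2) - g x * cnj (s x) - cnj (g x) * s x + s x * cnj (s x))
          has_integral of_real I - of_real S - of_real S + of_real S) {-1/2..1/2}"
    by (intro has_integral_add has_integral_diff I1 I2 I3 I4)
  also have "(\<lambda>x. of_real ((cmod (g x))\<^sup>2) - g x * cnj (s x) - cnj (g x) * s x + s x * cnj (s x))
      = (\<lambda>x. of_real ((cmod (g x - s x))\<^sup>2) :: complex)"
    by (simp only: complex_norm_square) (simp add: algebra_simps)
  finally have "((\<lambda>x. of_real ((cmod (g x - s x))\<^sup>2)) has_integral (of_real (I - S) :: complex)) {-1/2..1/2}"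
    by simp
  from has_integral_linear[OF this bounded_linear_Re]
  have "((\<lambda>x. (cmod (g x - s x))\<^sup>2) has_integral (I - S)) {-1/2..1/2}"
    by (simp add: o_def del: of_real_power)
  then have "0 \<le> I - S"
    by (rule has_integral_nonneg) auto
  then show ?thesis by (simp add: I_def S_def c_def)
qed

text \<open>
The Riemann-Lebesgue lemma, in the form in which it follows from Bessel's inequality: the squared
coefficients are summable.
\<close>

lemma fourier_coeff_tendsto_0:
  assumes g: "continuous_on {-1/2..1/2} g" and j: "inj (j :: nat \<Rightarrow> int)"
  shows "(\<lambda>n. fourier_coeff g (j n)) \<longlonglongrightarrow> 0"
proof -
  have "summable (\<lambda>n. (cmod (fourier_coeff g (j n)))\<^sup>2)"
  proof (rule summableI_nonneg_bounded)
    fix n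
    have "(\<Sum>i<n. (cmod (fourier_coeff g (j i)))\<^sup>2) = (\<Sum>i\<in>j ` {..<n}. (cmod (fourier_coeff g i))\<^sup>2)"
      by (subst sum.reindex) (use j in \<open>auto intro: inj_on_subset\<close>)
    also have "\<dots> \<le> integral {-1/2..1/2} (\<lambda>x. (cmod (g x))\<^sup>2)"
      by (rule bessel_inequality[OF g]) simp
    finally show "(\<Sum>i<n. (cmod (fourier_coeff g (j i)))\<^sup>2) \<le> integral {-1/2..1/2} (\<lambda>x. (cmod (g x))\<^sup>2)" .
  qed simp
  then have "(\<lambda>n. (cmod (fourier_coeff g (j n)))\<^sup>2) \<longlonglongrightarrow> 0"
    by (rule summable_LIMSEQ_zero)
  then have "(\<lambda>n. sqrt ((cmod (fourier_coeff g (j n)))\<^sup>2)) \<longlonglongrightarrow> sqrt 0"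
    by (rule tendsto_real_sqrt)
  then show ?thesis by (simp add: tendsto_norm_zero_iff)
qed

lemma sum_telescope_int:
  fixes f :: "int \<Rightarrow> 'a::ab_group_add"
  shows "(\<Sum>j=-int n..int n. f (j - 1) - f j) = f (- int (Suc n)) - f (int n)"
proof (induction n)
  case (Suc n)
  have "{-int (Suc n)..int (Suc n)} = insert (-int (Suc n)) (insert (int (Suc n)) {-int n..int n})"
    by auto
  then show ?case
    using Suc by (simp add: algebra_simps)
qed simp

lemma has_vector_derivative_tendsto_quotient:
  fixes g :: "real \<Rightarrow> 'a::real_normed_vector"
  assumes "(g has_vector_derivative D) (at 0)"
  shows "((\<lambda>y. (g y - g 0) /\<^sub>R y) \<longlongrightarrow> D) (at 0)"
proof -
  have "((\<lambda>y. (g y - g 0 - y *\<^sub>R D) /\<^sub>R norm y) \<longlongrightarrow> 0) (at 0)"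
    using assms by (simp add: has_vector_derivative_def has_derivative_def netlimit_at)
  then have "((\<lambda>y. norm ((g y - g 0 - y *\<^sub>R D) /\<^sub>R norm y)) \<longlongrightarrow> 0) (at 0)"
    by (rule tendsto_norm_zero)
  also have "?this \<longleftrightarrow> ((\<lambda>y. norm ((g y - g 0) /\<^sub>R y - D)) \<longlongrightarrow> 0) (at 0)"
  proof (intro filterlim_cong refl)
    have "norm ((g y - g 0 - y *\<^sub>R D) /\<^sub>R norm y) = norm ((g y - g 0) /\<^sub>R y - D)" if "y \<noteq> 0" for y
    proof -
      have "(g y - g 0) /\<^sub>R y - D = (g y - g 0 - y *\<^sub>R D) /\<^sub>R y"
        using that by (simp add: scaleR_diff_right)
      then show ?thesis by simp
    qed
    then show "\<forall>\<^sub>F y in at 0. norm ((g y - g 0 - y *\<^sub>R D) /\<^sub>R norm y) = norm ((g y - g 0) /\<^sub>R y - D)"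
      by (auto simp: eventually_at_filter)
  qed
  finally show ?thesis
    by (simp add: tendsto_norm_zero_iff LIM_zero_cancel)
qed

text \<open>
Chernoff's proof of pointwise convergence. Dividing \<open>g - g 0\<close> by \<open>exp (2 \<pi> \<i> x) - 1\<close> leaves a continuous function
\<open>k\<close>, because \<open>g\<close> is differentiable at \<open>0\<close>. Multiplication by \<open>exp (2 \<pi> \<i> x) - 1\<close> takes differences of
neighbouring Fourier coefficients, so the symmetric partial sums for \<open>g - g 0\<close> telescope to two outer
coefficients of \<open>k\<close>, and these tend to \<open>0\<close>.
\<close>

theorem fourier_series_at_0:
  assumes g: "continuous_on {-1/2..1/2} g" and g': "(g has_vector_derivative D) (at 0)"
  shows "(\<lambda>n. \<Sum>j=-int n..int n. fourier_coeff g j) \<longlonglongrightarrow> g 0"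
proof -
  define E where "E = (\<lambda>x::real. cis (2 * pi * x) - 1)"
  \<comment> \<open>The value at \<open>0\<close> is the limit of the quotient.\<close>
  define k where "k = (\<lambda>x. if x = 0 then D / (2 * pi * \<i>) else (g x - g 0) / E x)"
  have E0: "E x \<noteq> 0" if "x \<in> {-1/2..1/2}" "x \<noteq> 0" for x
  proof
    assume "E x = 0"
    then have "cos (2 * pi * x) = 1"
      by (simp add: E_def complex_eq_iff)
    then obtain n :: int where "2 * pi * x = of_int n * 2 * pi"
      by (auto simp: cos_one_2pi_int)
    then have "x = of_int n" by simp
    with that show False by auto
  qed
  have E': "(E has_vector_derivative (2 * pi * \<i>)) (at 0)"
  proof -
    have "((\<lambda>z. exp (\<i> * 2 * of_real pi * z) - 1) has_field_derivative 2 * pi * \<i>) (at (of_real 0))"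
      by (auto intro!: derivative_eq_intros)
    from has_vector_derivative_real_field[OF this, of UNIV] show ?thesis
      unfolding E_def cis_conv_exp by (simp add: mult_ac)
  qed
  have k: "continuous_on {-1/2..1/2} k"
    unfolding continuous_on_eq_continuous_within
  proof
    fix x :: real assume x: "x \<in> {-1/2..1/2}"
    show "continuous (at x within {-1/2..1/2}) k"
    proof (cases "x = 0")
      case True
      have "E 0 = 0" by (simp add: E_def)
      have "((\<lambda>y. ((g y - g 0) /\<^sub>R y) / ((E y - E 0) /\<^sub>R y)) \<longlongrightarrow> D / (2 * pi * \<i>)) (at 0)"
        using has_vector_derivative_tendsto_quotient[OF g'] has_vector_derivative_tendsto_quotient[OF E']
        by (intro tendsto_divide) auto
      also have "?this \<longleftrightarrow> (k \<longlongrightarrow> k 0) (at 0)"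
        unfolding \<open>E 0 = 0\<close> k_def
        by (intro filterlim_cong) (auto simp: eventually_at_filter divide_simps scaleR_conv_of_real)
      finally show ?thesis
        by (simp add: True continuous_within tendsto_within_subset[of _ _ _ UNIV])
    next
      case False
      have "continuous (at x within {-1/2..1/2}) (\<lambda>x. (g x - g 0) / E x)"
        using g x E0[OF x False] unfolding E_def cis_conv_exp
        by (intro continuous_intros) (auto simp: continuous_on_eq_continuous_within)
      moreover have "\<forall>\<^sub>F y in at x within {-1/2..1/2}. y \<noteq> 0"
        using False by (intro eventually_neq_at_within)
      ultimately show ?thesis
        unfolding continuous_within using False
        by (auto simp: k_def elim!: Lim_transform_eventually eventually_mono)
    qed
  qed
  have step: "fourier_coeff g j - g 0 * (if j = 0 then 1 else 0) = fourier_coeff k (j - 1) - fourier_coeff k j" for j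
  proof (rule has_integral_unique)
    show "((\<lambda>x. g x * cis (- (2 * pi * of_int j * x)) - g 0 * cis (2 * pi * of_int (-j) * x)) has_integral
            (fourier_coeff g j - g 0 * (if j = 0 then 1 else 0))) {-1/2..1/2}"
      using has_integral_cis_period[of "-j"]
      by (intro has_integral_diff has_integral_mult_right has_integral_fourier_coeff g) simp
    have "((\<lambda>x. k x * cis (- (2 * pi * of_int (j - 1) * x)) - k x * cis (- (2 * pi * of_int j * x))) has_integral
            (fourier_coeff k (j - 1) - fourier_coeff k j)) {-1/2..1/2}"
      by (intro has_integral_diff has_integral_fourier_coeff k)
    then show "((\<lambda>x. g x * cis (- (2 * pi * of_int j * x)) - g 0 * cis (2 * pi * of_int (-j) * x)) has_integral
            (fourier_coeff k (j - 1) - fourier_coeff k j)) {-1/2..1/2}"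
    proof (rule has_integral_eq[rotated])
      fix x :: real assume x: "x \<in> {-1/2..1/2}"
      have "cis (- (2 * pi * of_int (j - 1) * x)) = cis (- (2 * pi * of_int j * x)) * cis (2 * pi * x)"
        by (simp add: cis_mult algebra_simps)
      then have "k x * cis (- (2 * pi * of_int (j - 1) * x)) - k x * cis (- (2 * pi * of_int j * x))
          = k x * E x * cis (- (2 * pi * of_int j * x))"
        by (simp add: E_def algebra_simps)
      also have "k x * E x = g x - g 0"
        using E0[OF x] by (auto simp: k_def E_def)
      finally show "k x * cis (- (2 * pi * of_int (j - 1) * x)) - k x * cis (- (2 * pi * of_int j * x))
          = g x * cis (- (2 * pi * of_int j * x)) - g 0 * cis (2 * pi * of_int (-j) * x)"
        by (simp add: algebra_simps)
    qed
  qed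
  have eq: "(\<Sum>j=-int n..int n. fourier_coeff g j)
      = g 0 + (fourier_coeff k (- int (Suc n)) - fourier_coeff k (int n))" for n
  proof -
    have "(\<Sum>j=-int n..int n. fourier_coeff g j - g 0 * (if j = 0 then 1 else 0))
        = fourier_coeff k (- int (Suc n)) - fourier_coeff k (int n)"
      unfolding step by (rule sum_telescope_int)
    moreover have "(\<Sum>j=-int n..int n. g 0 * (if j = 0 then 1 else 0)) = g 0"
      by (simp add: if_distrib cong: if_cong)
    ultimately show ?thesis
      by (simp add: sum_subtractf algebra_simps)
  qed
  have "(\<lambda>n. g 0 + (fourier_coeff k (- int (Suc n)) - fourier_coeff k (int n))) \<longlonglongrightarrow> g 0 + (0 - 0)"
    by (intro tendsto_intros fourier_coeff_tendsto_0 k) (auto simp: inj_on_def)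
  then show ?thesis by (simp add: eq)
qed

section \<open>Poisson summation for Gaussians\<close>

lemma has_sum_int_split:
  fixes f :: "int \<Rightarrow> 'a::topological_comm_monoid_add"
  assumes "((\<lambda>n. f (int (Suc n))) has_sum a) UNIV" and "((\<lambda>n. f (- int (Suc n))) has_sum b) UNIV"
  shows "(f has_sum (f 0 + a + b)) UNIV"
proof -
  have "bij_betw (\<lambda>n. int (Suc n)) UNIV {0<..}"
    by (rule bij_betw_byWitness[where f' = "\<lambda>k. nat (k - 1)"]) auto
  then have 1: "(f has_sum a) {0<..}"
    using has_sum_reindex_bij_betw[of "\<lambda>n. int (Suc n)" UNIV "{0<..}" f a] assms(1) by blast
  have "bij_betw (\<lambda>n. - int (Suc n)) UNIV {..<0}"
    by (rule bij_betw_byWitness[where f' = "\<lambda>k. nat (- k - 1)"]) auto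
  then have 2: "(f has_sum b) {..<0}"
    using has_sum_reindex_bij_betw[of "\<lambda>n. - int (Suc n)" UNIV "{..<0}" f b] assms(2) by blast
  have "(f has_sum (f 0 + a + b)) ({0} \<union> {0<..} \<union> {..<0})"
    by (intro has_sum_Un_disjoint 1 2 has_sum_finiteI) auto
  also have "{0} \<union> {0<..} \<union> {..<0} = (UNIV :: int set)" by auto
  finally show ?thesis .
qed

lemma gaussian_summable_nat:
  fixes a :: real
  assumes "a > 0"
  shows "summable (\<lambda>n. exp (- a * real (Suc n) ^ 2))"
proof (rule summable_comparison_test')
  show "summable (\<lambda>n. exp (- a) ^ n)"
    using assms by (intro summable_geometric) simp
  fix n :: nat
  have "a * real n \<le> a * real (Suc n) ^ 2"
    using assms by (intro mult_left_mono) (auto simp: power2_eq_square algebra_simps)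
  then have "exp (- a * real (Suc n) ^ 2) \<le> exp (real n * (- a))" by (simp add: mult.commute)
  also have "\<dots> = exp (- a) ^ n" by (rule exp_of_nat_mult)
  finally show "norm (exp (- a * real (Suc n) ^ 2)) \<le> exp (- a) ^ n" by simp
qed

lemma gaussian_summable_int:
  fixes a :: real
  assumes "a > 0"
  shows "(\<lambda>n::int. exp (- a * of_int n ^ 2)) summable_on UNIV"
proof -
  obtain s where s: "((\<lambda>n. exp (- a * real (Suc n) ^ 2)) has_sum s) UNIV"
    using norm_summable_imp_has_sum[of "\<lambda>n. exp (- a * real (Suc n) ^ 2)"] gaussian_summable_nat[OF assms]
    by (auto simp: summable_def)
  have eq: "(real_of_int (- int (Suc n)))\<^sup>2 = (real (Suc n))\<^sup>2" "(real_of_int (int (Suc n)))\<^sup>2 = (real (Suc n))\<^sup>2" for n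
    by (simp_all only: of_int_minus of_int_of_nat_eq power2_minus)
  have "((\<lambda>n::int. exp (- a * of_int n ^ 2)) has_sum (exp (- a * of_int 0 ^ 2) + s + s)) UNIV"
    by (rule has_sum_int_split) (unfold eq, rule s, rule s)
  then show ?thesis by (rule has_sum_imp_summable)
qed

text \<open>
The Fourier transform of a Gaussian is the characteristic function of the normal distribution, up to
scaling.
\<close>

lemma has_bochner_integral_gaussian_cis:
  fixes t s :: real
  assumes t: "t > 0"
  shows "has_bochner_integral lborel (\<lambda>y. of_real (exp (- pi * t * y\<^sup>2)) * cis (s * y))
           (of_real (exp (- s\<^sup>2 / (4 * pi * t)) / sqrt t))"
proof -
  \<comment> \<open>Chosen so that \<open>(c y)\<^sup>2 / 2 = \<pi> t y\<^sup>2\<close>.\<close>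
  define c where "c = sqrt (2 * pi * t)"
  have c: "c > 0" "c\<^sup>2 = 2 * pi * t" using t by (simp_all add: c_def)
  define r where "r = s / c"
  have int: "integrable lborel (\<lambda>y. std_normal_density y *\<^sub>R iexp (r * y))"
    by (rule Bochner_Integration.integrable_bound[of _ "std_normal_density"])
       (auto simp: norm_mult simp del: of_real_mult intro!: integrable_normal_density)
  have "(\<integral>y. std_normal_density y *\<^sub>R iexp (r * y) \<partial>lborel) = char std_normal_distribution r"
    unfolding char_def by (rule integral_density[symmetric]) auto
  also have "\<dots> = of_real (exp (- (r\<^sup>2) / 2))"
    by (simp only: char_std_normal_distribution)
  finally have "has_bochner_integral lborel (\<lambda>y. std_normal_density y *\<^sub>R iexp (r * y)) (of_real (exp (- (r\<^sup>2) / 2)))"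
    using int by (simp add: has_bochner_integral_iff)
  then have "has_bochner_integral lborel (\<lambda>y. std_normal_density (0 + c * y) *\<^sub>R iexp (r * (0 + c * y)))
      (of_real (exp (- (r\<^sup>2) / 2)) /\<^sub>R \<bar>c\<bar>)"
    using c by (subst (asm) lborel_has_bochner_integral_real_affine_iff[where c = c and t = 0]) auto
  then have "has_bochner_integral lborel (\<lambda>y. of_real (sqrt (2 * pi)) * (std_normal_density (0 + c * y) *\<^sub>R iexp (r * (0 + c * y))))
      (of_real (sqrt (2 * pi)) * (of_real (exp (- (r\<^sup>2) / 2)) /\<^sub>R \<bar>c\<bar>))"
    by (rule has_bochner_integral_mult_right)
  also have "(\<lambda>y. of_real (sqrt (2 * pi)) * (std_normal_density (0 + c * y) *\<^sub>R iexp (r * (0 + c * y))))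
      = (\<lambda>y. of_real (exp (- pi * t * y\<^sup>2)) * cis (s * y))"
    using c by (simp add: std_normal_density_def fun_eq_iff scaleR_conv_of_real cis_conv_exp r_def
        power_mult_distrib exp_of_real real_sqrt_mult)
  also have "of_real (sqrt (2 * pi)) * (of_real (exp (- (r\<^sup>2) / 2)) /\<^sub>R \<bar>c\<bar>)
      = (of_real (exp (- s\<^sup>2 / (4 * pi * t)) / sqrt t) :: complex)"
  proof -
    have "r\<^sup>2 / 2 = s\<^sup>2 / (4 * pi * t)"
      using c by (simp add: r_def power_divide)
    moreover have "sqrt (2 * pi) / c = 1 / sqrt t"
      using t by (simp add: c_def real_sqrt_mult)
    moreover have "sqrt (2 * pi) * (exp (- (r\<^sup>2) / 2) / c) = sqrt (2 * pi) / c * exp (- (r\<^sup>2 / 2))"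
      by simp
    ultimately have "sqrt (2 * pi) * (exp (- (r\<^sup>2) / 2) / c) = exp (- s\<^sup>2 / (4 * pi * t)) / sqrt t"
      by simp
    then show ?thesis
      using c unfolding scaleR_conv_of_real of_real_mult[symmetric]
      by (intro arg_cong[where f = of_real]) (simp add: field_simps)
  qed
  finally show ?thesis .
qed

text \<open>
The argument is complex because the sum, as a locally uniform limit of entire functions, is then entire, which
supplies continuity and differentiability on the real line without estimates of derivatives.
\<close>

definition theta_sum :: "real \<Rightarrow> complex \<Rightarrow> complex" where
  "theta_sum t v = (\<Sum>\<^sub>\<infinity>n::int. exp (- of_real (pi * t) * (of_int n + v)\<^sup>2))"

lemma norm_theta_term_le:
  fixes n :: int and v :: complex
  assumes t: "t > 0" and v: "v \<in> cball 0 R"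
  shows "norm (exp (- of_real (pi * t) * (of_int n + v)\<^sup>2))
           \<le> exp (pi * t * R\<^sup>2) * exp (- (pi * t / 2) * of_int n ^ 2)"
proof -
  have "(of_int n)\<^sup>2 / 2 \<le> (of_int n + Re v)\<^sup>2 + (Re v)\<^sup>2"
  proof -
    have "0 \<le> (of_int n / 2 + Re v)\<^sup>2" by simp
    then show ?thesis by (simp add: power2_eq_square field_simps)
  qed
  moreover have "(Re v)\<^sup>2 + (Im v)\<^sup>2 \<le> R\<^sup>2"
    unfolding cmod_power2[symmetric] using v by (intro power_mono) auto
  ultimately have "(of_int n)\<^sup>2 / 2 - R\<^sup>2 \<le> (of_int n + Re v)\<^sup>2 - (Im v)\<^sup>2" by linarith
  then have "pi * t * ((of_int n)\<^sup>2 / 2 - R\<^sup>2) \<le> pi * t * ((of_int n + Re v)\<^sup>2 - (Im v)\<^sup>2)"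
    using t by (intro mult_left_mono) auto
  moreover have "Re (- of_real (pi * t) * (of_int n + v)\<^sup>2) = - (pi * t * ((of_int n + Re v)\<^sup>2 - (Im v)\<^sup>2))"
    by (simp add: Re_power2)
  ultimately show ?thesis
    unfolding norm_exp_eq_Re exp_add[symmetric] by (simp add: algebra_simps)
qed

lemma theta_sum_uniform_limit:
  assumes t: "t > 0"
  shows "uniform_limit (cball 0 R) (\<lambda>X v::complex. \<Sum>n\<in>X. exp (- of_real (pi * t) * (of_int n + v)\<^sup>2))
           (theta_sum t) (finite_subsets_at_top (UNIV :: int set))"
  unfolding theta_sum_def
proof (rule Weierstrass_m_test_general)
  show "(\<lambda>n::int. exp (pi * t * R\<^sup>2) * exp (- (pi * t / 2) * of_int n ^ 2)) summable_on UNIV"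
    using t by (intro summable_on_cmult_right gaussian_summable_int) auto
qed (rule norm_theta_term_le[OF t])

lemma theta_sum_has_sum:
  assumes t: "t > 0"
  shows "((\<lambda>n::int. exp (- of_real (pi * t) * (of_int n + v)\<^sup>2)) has_sum theta_sum t v) UNIV"
  unfolding has_sum_def
  using tendsto_uniform_limitI[OF theta_sum_uniform_limit[OF t], of v "norm v"] by simp

lemma theta_sum_holomorphic:
  assumes t: "t > 0"
  shows "theta_sum t holomorphic_on UNIV"
proof -
  have "theta_sum t holomorphic_on ball 0 R" for R
  proof -
    have "\<forall>\<^sub>F X in finite_subsets_at_top (UNIV :: int set).
        continuous_on (cball 0 R) (\<lambda>v::complex. \<Sum>n\<in>X. exp (- of_real (pi * t) * (of_int n + v)\<^sup>2)) \<and>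
        (\<lambda>v::complex. \<Sum>n\<in>X. exp (- of_real (pi * t) * (of_int n + v)\<^sup>2)) holomorphic_on ball 0 R"
      by (intro always_eventually allI conjI continuous_intros holomorphic_intros)
    from holomorphic_uniform_limit[OF this theta_sum_uniform_limit[OF t]] show ?thesis by simp
  qed
  then have "theta_sum t field_differentiable (at v)" for v
    by (rule holomorphic_on_imp_differentiable_at[of _ "ball 0 (norm v + 1)"]) auto
  then show ?thesis
    by (simp add: holomorphic_on_def field_differentiable_at_within)
qed

text \<open>
Unordered sums over the integers are limits of their symmetric partial sums; this connects them with the
symmetric partial sums of Fourier series.
\<close>

lemma filterlim_symmetric_interval:
  "filterlim (\<lambda>M. {- int M..int M}) (finite_subsets_at_top UNIV) sequentially"
  unfolding filterlim_finite_subsets_at_top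
proof (intro allI impI)
  fix X :: "int set" assume X: "finite X \<and> X \<subseteq> UNIV"
  define B where "B = Max (abs ` X)"
  have B: "\<bar>x\<bar> \<le> B" if "x \<in> X" for x
    unfolding B_def using X that by (intro Max_ge) auto
  show "\<forall>\<^sub>F M in sequentially. finite {- int M..int M} \<and> X \<subseteq> {- int M..int M} \<and> {- int M..int M} \<subseteq> UNIV"
    using eventually_ge_at_top[of "nat B"]
  proof eventually_elim
    case (elim M)
    then show ?case using B by force
  qed
qed

lemma integral_unfold_period:
  fixes u :: "real \<Rightarrow> complex"
  assumes u: "continuous_on UNIV u"
  shows "(\<Sum>n=-int M..int M. integral {-1/2..1/2} (\<lambda>y. u (y + of_int n)))
           = integral {- (real M + 1/2)..real M + 1/2} u"
proof (induction M)
  case 0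
  then show ?case by simp
next
  case (Suc M)
  have int: "u integrable_on {a..b}" for a b
    by (rule integrable_continuous_interval[OF continuous_on_subset[OF u]]) simp
  have sh: "integral {-1/2..1/2} (\<lambda>y. u (y + c)) = integral {-1/2 + c..1/2 + c} u" for c
    using integral_shift[of "-1/2" c "1/2" u] continuous_on_subset[OF u] by (simp add: o_def)
  have set: "{-int (Suc M)..int (Suc M)} = insert (-int (Suc M)) (insert (int (Suc M)) {-int M..int M})"
    by auto
  have "(\<Sum>n=-int (Suc M)..int (Suc M). integral {-1/2..1/2} (\<lambda>y. u (y + of_int n)))
      = integral {-1/2 + of_int (- int (Suc M))..1/2 + of_int (- int (Suc M))} u
        + (integral {-1/2 + of_int (int (Suc M))..1/2 + of_int (int (Suc M))} u
        + integral {- (real M + 1/2)..real M + 1/2} u)"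
    unfolding set by ((subst sum.insert, simp, simp)+, simp only: Suc.IH, simp only: sh)
  also have "integral {-1/2 + of_int (int (Suc M))..1/2 + of_int (int (Suc M))} u
        + integral {- (real M + 1/2)..real M + 1/2} u
      = integral {- (real M + 1/2)..real (Suc M) + 1/2} u"
  proof -
    have "-1/2 + of_int (int (Suc M)) = real M + 1/2" "1/2 + of_int (int (Suc M)) = real (Suc M) + 1/2" by simp_all
    then show ?thesis
      using Henstock_Kurzweil_Integration.integral_combine[OF _ _ int, of "- (real M + 1/2)" "real M + 1/2" "real (Suc M) + 1/2"]
      by (simp add: add.commute)
  qed
  also have "integral {-1/2 + of_int (- int (Suc M))..1/2 + of_int (- int (Suc M))} u + \<dots>
      = integral {- (real (Suc M) + 1/2)..real (Suc M) + 1/2} u"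
  proof -
    have "-1/2 + of_int (- int (Suc M)) = - (real (Suc M) + 1/2)" "1/2 + of_int (- int (Suc M)) = - (real M + 1/2)" by simp_all
    then show ?thesis
      using Henstock_Kurzweil_Integration.integral_combine[OF _ _ int, of "- (real (Suc M) + 1/2)" "- (real M + 1/2)" "real (Suc M) + 1/2"]
      by (simp only:)
  qed
  finally show ?case .
qed

lemma tendsto_integral_symmetric_interval:
  fixes u :: "real \<Rightarrow> complex"
  assumes u: "has_bochner_integral lborel u I"
  shows "(\<lambda>M. integral {- (real M + 1/2)..real M + 1/2} u) \<longlonglongrightarrow> I"
proof -
  have int: "integrable lborel u" and I: "I = integral\<^sup>L lborel u" using u by (auto simp: has_bochner_integral_iff)
  have [measurable]: "u \<in> borel_measurable lborel" using int by (rule borel_measurable_integrable)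
  have "(\<lambda>M. LINT y|lborel. indicator {- (real M + 1/2)..real M + 1/2} y *\<^sub>R u y) \<longlonglongrightarrow> integral\<^sup>L lborel u"
  proof (rule integral_dominated_convergence[where w = "\<lambda>y. norm (u y)"])
    show "AE y in lborel. (\<lambda>M. indicator {- (real M + 1/2)..real M + 1/2} y *\<^sub>R u y) \<longlonglongrightarrow> u y"
    proof (rule AE_I2)
      fix y :: real
      have "\<forall>\<^sub>F M in sequentially. indicator {- (real M + 1/2)..real M + 1/2} y *\<^sub>R u y = u y"
        using eventually_ge_at_top[of "nat \<lceil>\<bar>y\<bar>\<rceil>"]
      proof eventually_elim
        case (elim M)
        then have "\<bar>y\<bar> \<le> real M" by linarith
        then show ?case by (auto simp: indicator_def)
      qed
      then show "(\<lambda>M. indicator {- (real M + 1/2)..real M + 1/2} y *\<^sub>R u y) \<longlonglongrightarrow> u y"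
        by (rule tendsto_eventually)
    qed
  qed (use int in \<open>auto simp: indicator_def\<close>)
  moreover have "(LINT y|lborel. indicator {- (real M + 1/2)..real M + 1/2} y *\<^sub>R u y)
      = integral {- (real M + 1/2)..real M + 1/2} u" for M
    using set_borel_integral_eq_integral(2)[of "{- (real M + 1/2)..real M + 1/2}" u] int
      integrable_mult_indicator[OF _ int, of "{- (real M + 1/2)..real M + 1/2}"]
    unfolding set_lebesgue_integral_def set_integrable_def by simp
  ultimately show ?thesis by (simp add: I)
qed

text \<open>
Unfolding: since \<open>exp (- 2 \<pi> \<i> j y)\<close> has period 1, integrating the sum of all integer translates over one period
amounts to integrating a single Gaussian over the real line.
\<close>

lemma fourier_coeff_theta_sum:
  fixes t x :: real
  assumes t: "t > 0"
  shows "fourier_coeff (\<lambda>y. theta_sum t (of_real (x + y))) j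
           = cis (2 * pi * of_int j * x) * of_real (exp (- pi * of_int j ^ 2 / t) / sqrt t)"
proof -
  define g where "g = (\<lambda>y::real. theta_sum t (of_real (x + y)))"
  define w where "w = (\<lambda>y. cis (- (2 * pi * of_int j * y)))"
  define u where "u = (\<lambda>y. of_real (exp (- pi * t * (x + y)\<^sup>2)) * w y)"
  define I where "I = cis (2 * pi * of_int j * x) * of_real (exp (- pi * of_int j ^ 2 / t) / sqrt t)"
  have u: "continuous_on UNIV u"
    unfolding u_def w_def by (intro continuous_intros)
  have "has_bochner_integral lborel (\<lambda>y. cis (2 * pi * of_int j * x) *
      (of_real (exp (- pi * t * (x + 1 * y)\<^sup>2)) * cis (- (2 * pi * of_int j) * (x + 1 * y))))
      (cis (2 * pi * of_int j * x) * (of_real (exp (- (- (2 * pi * of_int j))\<^sup>2 / (4 * pi * t)) / sqrt t) /\<^sub>R \<bar>1\<bar>))"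
    by (intro has_bochner_integral_mult_right
         lborel_has_bochner_integral_real_affine_iff[where c = 1 and t = x, THEN iffD1] has_bochner_integral_gaussian_cis t) simp
  also have "(\<lambda>y. cis (2 * pi * of_int j * x) *
      (of_real (exp (- pi * t * (x + 1 * y)\<^sup>2)) * cis (- (2 * pi * of_int j) * (x + 1 * y)))) = u"
  proof
    fix y
    have "cis (2 * pi * of_int j * x) * cis (- (2 * pi * of_int j) * (x + 1 * y)) = w y"
      unfolding cis_mult w_def by (rule arg_cong[where f = cis]) (simp add: algebra_simps)
    then show "cis (2 * pi * of_int j * x) *
      (of_real (exp (- pi * t * (x + 1 * y)\<^sup>2)) * cis (- (2 * pi * of_int j) * (x + 1 * y))) = u y"
      by (simp add: u_def mult_ac)
  qed
  also have "cis (2 * pi * of_int j * x) * (of_real (exp (- (- (2 * pi * of_int j))\<^sup>2 / (4 * pi * t)) / sqrt t) /\<^sub>R \<bar>1\<bar>) = I"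
  proof -
    have "(2 * pi * of_int j)\<^sup>2 / (4 * pi * t) = pi * of_int j ^ 2 / t"
      using t by (simp add: power2_eq_square field_simps)
    then show ?thesis by (simp add: I_def)
  qed
  finally have "has_bochner_integral lborel u I" .
  then have lim1: "(\<lambda>M. integral {- (real M + 1/2)..real M + 1/2} u) \<longlonglongrightarrow> I"
    by (rule tendsto_integral_symmetric_interval)
  define P where "P = (\<lambda>M::nat. \<lambda>y::real. (\<Sum>n=-int M..int M. exp (- of_real (pi * t) * (of_int n + of_real (x + y))\<^sup>2)) * w y)"
  have lim2: "uniform_limit {-1/2..1/2} P (\<lambda>y. g y * w y) sequentially"
  proof -
    have "uniform_limit (cball 0 (\<bar>x\<bar> + 1)) (\<lambda>M v. \<Sum>n=-int M..int M. exp (- of_real (pi * t) * (of_int n + v)\<^sup>2))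
           (theta_sum t) sequentially"
      using filterlim_compose[OF theta_sum_uniform_limit[OF t] filterlim_symmetric_interval] .
    then have "uniform_limit {-1/2..1/2} (\<lambda>M y. \<Sum>n=-int M..int M. exp (- of_real (pi * t) * (of_int n + of_real (x + y))\<^sup>2))
        g sequentially"
      unfolding g_def by (rule uniform_limit_compose') (auto simp: dist_norm simp flip: of_real_add)
    then show ?thesis
      unfolding P_def uniform_limit_iff w_def
      by (simp add: dist_norm norm_mult flip: left_diff_distrib)
  qed
  have "continuous_on (cbox (-1/2) (1/2)) (P M)" for M
    unfolding P_def w_def by (intro continuous_intros)
  note cont = this
  have "uniform_limit (cbox (-1/2) (1/2)) P (\<lambda>y. g y * w y) sequentially"
    using lim2 by simp
  from uniform_limit_integral_cbox[OF this cont sequentially_bot]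
  obtain II J where IJ: "\<And>M. (P M has_integral II M) {-1/2..1/2}"
      "((\<lambda>y. g y * w y) has_integral J) {-1/2..1/2}" "II \<longlonglongrightarrow> J"
    unfolding box_real by blast
  have "II M = integral {- (real M + 1/2)..real M + 1/2} u" for M
  proof -
    have "II M = integral {-1/2..1/2} (P M)"
      by (rule integral_unique[OF IJ(1), symmetric])
    also have "P M = (\<lambda>y. \<Sum>n=-int M..int M. u (y + of_int n))"
    proof
      fix y
      have "exp (- of_real (pi * t) * (of_int n + of_real (x + y))\<^sup>2) * w y = u (y + of_int n)" for n
      proof -
        have "w (y + of_int n) = w y * cis (2 * pi * of_int (- (j * n)))"
          unfolding w_def cis_mult by (rule arg_cong[where f = cis]) (simp add: algebra_simps)
        also have "cis (2 * pi * of_int (- (j * n))) = 1"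
          by (rule cis_multiple_2pi) (rule Ints_of_int)
        finally have "w (y + of_int n) = w y" by simp
        moreover have "exp (- of_real (pi * t) * (of_int n + of_real (x + y))\<^sup>2)
            = (of_real (exp (- pi * t * (x + (y + of_int n))\<^sup>2)) :: complex)"
          by (simp add: algebra_simps flip: exp_of_real)
        ultimately show ?thesis by (simp add: u_def)
      qed
      then show "P M y = (\<Sum>n=-int M..int M. u (y + of_int n))"
        by (simp add: P_def sum_distrib_right)
    qed
    also have "integral {-1/2..1/2} \<dots> = (\<Sum>n=-int M..int M. integral {-1/2..1/2} (\<lambda>y. u (y + of_int n)))"
      by (intro Henstock_Kurzweil_Integration.integral_sum integrable_continuous_interval
          continuous_on_compose2[OF u] continuous_intros) auto
    also have "\<dots> = integral {- (real M + 1/2)..real M + 1/2} u"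
      by (rule integral_unfold_period[OF u])
    finally show ?thesis .
  qed
  then have "II = (\<lambda>M. integral {- (real M + 1/2)..real M + 1/2} u)" ..
  with lim1 IJ(3) have "J = I"
    by (metis LIMSEQ_unique)
  with integral_unique[OF IJ(2)] show ?thesis
    unfolding fourier_coeff_def g_def w_def I_def by simp
qed

text \<open>
Poisson summation for Gaussians: the Fourier series at \<open>0\<close> of the function \<open>y \<mapsto> theta_sum t (x + y)\<close>.
\<close>

theorem theta_sum_reciprocity:
  fixes t x :: real
  assumes t: "t > 0"
  shows "((\<lambda>k::int. cis (2 * pi * of_int k * x) * of_real (exp (- pi * of_int k ^ 2 / t)))
           has_sum (of_real (sqrt t) * theta_sum t (of_real x))) UNIV"
proof -
  define g where "g = (\<lambda>y::real. theta_sum t (of_real (x + y)))"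
  define e where "e = (\<lambda>k::int. cis (2 * pi * of_int k * x) * of_real (exp (- pi * of_int k ^ 2 / t)))"
  obtain D where "(theta_sum t has_field_derivative D) (at (of_real x))"
    using theta_sum_holomorphic[OF t] by (metis UNIV_I field_differentiable_def holomorphic_on_imp_differentiable_at open_UNIV)
  then have "((\<lambda>v. theta_sum t (of_real x + v)) has_field_derivative D) (at (of_real 0))"
    using DERIV_shift[of "theta_sum t" D 0 "of_real x"] by (simp add: add.commute)
  from has_vector_derivative_real_field[OF this, of UNIV]
  have g': "(g has_vector_derivative D) (at 0)"
    by (simp add: g_def)
  have g: "continuous_on {-1/2..1/2} g"
    unfolding g_def
    by (intro continuous_on_compose2[OF holomorphic_on_imp_continuous_on[OF theta_sum_holomorphic[OF t]]] continuous_intros) auto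
  have "(\<lambda>n. \<Sum>j=-int n..int n. fourier_coeff g j) \<longlonglongrightarrow> g 0"
    by (rule fourier_series_at_0[OF g g'])
  then have "(\<lambda>n. of_real (sqrt t) * (\<Sum>j=-int n..int n. fourier_coeff g j)) \<longlonglongrightarrow> of_real (sqrt t) * g 0"
    by (rule tendsto_mult_left)
  moreover have "of_real (sqrt t) * (\<Sum>j=-int n..int n. fourier_coeff g j) = (\<Sum>j=-int n..int n. e j)" for n
    unfolding g_def fourier_coeff_theta_sum[OF t] sum_distrib_left e_def using t by (intro sum.cong) auto
  ultimately have lim: "(\<lambda>n. \<Sum>j=-int n..int n. e j) \<longlonglongrightarrow> of_real (sqrt t) * g 0" by simp
  have "(\<lambda>k. norm (e k)) summable_on UNIV"
    using gaussian_summable_int[of "pi / t"] t by (simp add: e_def norm_mult)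
  then obtain S where S: "(e has_sum S) UNIV"
    using Infinite_Sum.abs_summable_summable[of e UNIV] by (auto simp: summable_on_def)
  then have "(\<lambda>n. \<Sum>j=-int n..int n. e j) \<longlonglongrightarrow> S"
    unfolding has_sum_def by (rule filterlim_compose[OF _ filterlim_symmetric_interval])
  with lim have "S = of_real (sqrt t) * g 0" by (rule LIMSEQ_unique[rotated])
  with S show ?thesis by (simp add: e_def g_def)
qed

section \<open>Series over the squares\<close>

text \<open>
The factors \<open>\<pi> n\<^sup>2\<close> in the denominator are the exponents, so that
lowering \<open>j\<close> is, up to sign, differentiation in \<open>w\<close>.
\<close>

definition square_term :: "nat \<Rightarrow> (int \<Rightarrow> complex) \<Rightarrow> complex \<Rightarrow> nat \<Rightarrow> complex" where
  "square_term j b w n = b (int (Suc n)) / of_real (pi * real (Suc n) ^ 2) ^ j * exp (- of_real (pi * real (Suc n) ^ 2) * w)"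

definition square_series :: "nat \<Rightarrow> (int \<Rightarrow> complex) \<Rightarrow> complex \<Rightarrow> complex" where
  "square_series j b w = (\<Sum>n. square_term j b w n)"

lemma summable_inverse_Suc_square: "summable (\<lambda>n. 1 / real (Suc n) ^ 2)"
  using inverse_squares_sums by (auto simp: sums_iff)

lemma one_le_pi_square: "1 \<le> pi * real (Suc n) ^ 2"
proof -
  have "1 * 1 \<le> pi * real (Suc n) ^ 2"
    using pi_gt3 by (intro mult_mono) auto
  then show ?thesis by simp
qed

text \<open>
For \<open>j = 0\<close> convergence comes from the exponential factor alone, away from the imaginary axis.
\<close>

lemma norm_square_term_le_right:
  assumes b: "\<And>k. norm (b k) \<le> B" and w: "d \<le> Re w"
  shows "norm (square_term j b w n) \<le> B * exp (- (pi * d) * real (Suc n) ^ 2)"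
proof -
  have B: "B \<ge> 0" using b[of 0] norm_ge_zero order_trans by blast
  have "norm (square_term j b w n) = norm (b (int (Suc n))) / (pi * real (Suc n) ^ 2) ^ j * exp (- (pi * real (Suc n) ^ 2) * Re w)"
    unfolding square_term_def by (simp add: norm_mult norm_divide norm_power power_mult_distrib del: of_nat_Suc)
  also have "\<dots> \<le> B * exp (- (pi * d) * real (Suc n) ^ 2)"
  proof (rule mult_mono)
    have "norm (b (int (Suc n))) / (pi * real (Suc n) ^ 2) ^ j \<le> B / 1"
      using b B one_le_pi_square by (intro frac_le one_le_power) auto
    then show "norm (b (int (Suc n))) / (pi * real (Suc n) ^ 2) ^ j \<le> B" by simp
    have "(pi * real (Suc n) ^ 2) * d \<le> (pi * real (Suc n) ^ 2) * Re w"
      using w by (intro mult_left_mono) auto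
    then show "exp (- (pi * real (Suc n) ^ 2) * Re w) \<le> exp (- (pi * d) * real (Suc n) ^ 2)"
      by (simp add: mult_ac del: of_nat_Suc)
  qed (use B in auto)
  finally show ?thesis .
qed

text \<open>
For \<open>j \<ge> 1\<close> the denominators alone give convergence, uniformly up to the imaginary axis. This is what makes the
boundary values, among them Riemann's function, accessible.
\<close>

lemma norm_square_term_le_closed:
  assumes b: "\<And>k. norm (b k) \<le> B" and w: "0 \<le> Re w" and j: "j \<ge> 1"
  shows "norm (square_term j b w n) \<le> B * (1 / real (Suc n) ^ 2)"
proof -
  have B: "B \<ge> 0" using b[of 0] norm_ge_zero order_trans by blast
  have "norm (square_term j b w n) = norm (b (int (Suc n))) / (pi * real (Suc n) ^ 2) ^ j * exp (- (pi * real (Suc n) ^ 2) * Re w)"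
    unfolding square_term_def by (simp add: norm_mult norm_divide norm_power power_mult_distrib del: of_nat_Suc)
  also have "\<dots> \<le> B / real (Suc n) ^ 2 * 1"
  proof (intro mult_mono frac_le)
    have "real (Suc n) ^ 2 \<le> pi * real (Suc n) ^ 2"
      using pi_gt3 by (simp add: mult_le_cancel_right1)
    also have "\<dots> = (pi * real (Suc n) ^ 2) ^ 1" by simp
    also have "\<dots> \<le> (pi * real (Suc n) ^ 2) ^ j"
      by (rule power_increasing[OF j one_le_pi_square])
    finally show "real (Suc n) ^ 2 \<le> (pi * real (Suc n) ^ 2) ^ j" .
    have "0 \<le> pi * real (Suc n) ^ 2 * Re w" using w by simp
    then show "exp (- (pi * real (Suc n) ^ 2) * Re w) \<le> 1"
      unfolding exp_le_one_iff mult_minus_left neg_le_0_iff_le .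
    show "norm (b (int (Suc n))) \<le> B" by (rule b)
    show "0 < real (Suc n) ^ 2" by simp
    show "0 \<le> B / real (Suc n) ^ 2" using B by simp
  qed (simp_all add: B)
  finally show ?thesis by simp
qed

lemma summable_norm_square_term:
  assumes b: "\<And>k. norm (b k) \<le> B" and w: "0 < Re w"
  shows "summable (\<lambda>n. norm (square_term j b w n))"
proof (rule summable_comparison_test')
  show "summable (\<lambda>n. B * exp (- (pi * Re w) * real (Suc n) ^ 2))"
    using w by (intro summable_mult gaussian_summable_nat) auto
qed (use norm_square_term_le_right[OF b order_refl] in auto)

lemma square_series_sums:
  assumes b: "\<And>k. norm (b k) \<le> B" and w: "0 < Re w"
  shows "square_term j b w sums square_series j b w"
  unfolding square_series_def
  by (rule summable_sums[OF summable_norm_cancel[OF summable_norm_square_term[OF assms]]])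

lemma square_series_sums_closed:
  assumes b: "\<And>k. norm (b k) \<le> B" and w: "0 \<le> Re w" and j: "j \<ge> 1"
  shows "square_term j b w sums square_series j b w"
  unfolding square_series_def
  by (intro summable_sums summable_comparison_test'[OF summable_mult[OF summable_inverse_Suc_square], of 0 _ B]
        norm_square_term_le_closed[OF assms])

lemma norm_square_series_le:
  assumes b: "\<And>k. norm (b k) \<le> B" and w: "0 \<le> Re w" and j: "j \<ge> 1"
  shows "norm (square_series j b w) \<le> B * (\<Sum>n. 1 / real (Suc n) ^ 2)"
proof -
  have "norm (square_series j b w) \<le> (\<Sum>n. B * (1 / real (Suc n) ^ 2))"
    unfolding square_series_def
    by (intro norm_suminf_le summable_mult summable_inverse_Suc_square norm_square_term_le_closed[OF assms])
  also have "\<dots> = B * (\<Sum>n. 1 / real (Suc n) ^ 2)"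
    by (rule suminf_mult[OF summable_inverse_Suc_square])
  finally show ?thesis .
qed

lemma square_series_uniform_limit:
  assumes b: "\<And>k. norm (b k) \<le> B" and j: "j \<ge> 1"
  shows "uniform_limit {w. 0 \<le> Re w} (\<lambda>N w. \<Sum>n<N. square_term j b w n) (square_series j b) sequentially"
  unfolding square_series_def
proof (rule Weierstrass_m_test)
  show "summable (\<lambda>n. B * (1 / real (Suc n) ^ 2))"
    by (intro summable_mult summable_inverse_Suc_square)
qed (use norm_square_term_le_closed[OF b _ j] in auto)

lemma square_series_continuous:
  assumes b: "\<And>k. norm (b k) \<le> B" and j: "j \<ge> 1"
  shows "continuous_on {w. 0 \<le> Re w} (square_series j b)"
  by (rule uniform_limit_theorem[OF _ square_series_uniform_limit[OF assms]])
     (auto intro!: always_eventually continuous_intros simp: square_term_def simp del: of_nat_Suc)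

text \<open>
Holomorphic sequences may be differentiated term by term under locally uniform convergence, and the
series for \<open>Suc j\<close> already converges uniformly.
\<close>

lemma square_series_has_field_derivative:
  assumes b: "\<And>k. norm (b k) \<le> B" and w: "0 < Re w"
  shows "(square_series (Suc j) b has_field_derivative - square_series j b w) (at w)"
proof -
  have "\<exists>g'. \<forall>w\<in>{w. 0 < Re w}. (square_series (Suc j) b has_field_derivative g' w) (at w) \<and>
          (\<lambda>N. \<Sum>n<N. - square_term j b w n) \<longlonglongrightarrow> g' w"
  proof (rule has_complex_derivative_uniform_sequence)
    show "open {w. 0 < Re w}" by (rule open_halfspace_Re_gt)
  next
    fix N and w :: complex
    show "((\<lambda>w. \<Sum>n<N. square_term (Suc j) b w n) has_field_derivative (\<Sum>n<N. - square_term j b w n)) (at w)"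
    proof (rule DERIV_sum)
      fix n
      define a where "a = complex_of_real (pi * real (Suc n) ^ 2)"
      have "a \<noteq> 0" by (simp add: a_def del: of_nat_Suc)
      then show "((\<lambda>w. square_term (Suc j) b w n) has_field_derivative - square_term j b w n) (at w)"
        unfolding square_term_def a_def[symmetric] by (auto intro!: derivative_eq_intros simp: field_simps)
    qed
  next
    fix w :: complex assume "w \<in> {w. 0 < Re w}"
    then have w: "Re w > 0" by simp
    have sub: "cball w (Re w / 2) \<subseteq> {w. 0 \<le> Re w} \<inter> {w. 0 < Re w}"
    proof
      fix z assume "z \<in> cball w (Re w / 2)"
      then have "\<bar>Re w - Re z\<bar> \<le> Re w / 2"
        using abs_Re_le_cmod[of "w - z"] by (simp add: dist_norm)
      then have "Re z > 0" using w by linarith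
      then show "z \<in> {w. 0 \<le> Re w} \<inter> {w. 0 < Re w}" by simp
    qed
    show "\<exists>d>0. cball w d \<subseteq> {w. 0 < Re w} \<and>
        uniform_limit (cball w d) (\<lambda>N w. \<Sum>n<N. square_term (Suc j) b w n) (square_series (Suc j) b) sequentially"
      using sub w by (intro exI[of _ "Re w / 2"] conjI uniform_limit_on_subset[OF square_series_uniform_limit[OF b]]) auto
  qed
  then obtain g' where g': "(square_series (Suc j) b has_field_derivative g') (at w)"
      "(\<lambda>N. \<Sum>n<N. - square_term j b w n) \<longlonglongrightarrow> g'"
    using w by blast
  have "(\<lambda>n. - square_term j b w n) sums (- square_series j b w)"
    by (intro sums_minus square_series_sums[OF b w])
  then have "g' = - square_series j b w"
    using g'(2) LIMSEQ_unique unfolding sums_def by blast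
  with g'(1) show ?thesis by simp
qed

text \<open>
Obtained as the derivative of a holomorphic function, which covers \<open>j = 0\<close> as well.
\<close>

lemma square_series_holomorphic:
  assumes b: "\<And>k. norm (b k) \<le> B"
  shows "square_series j b holomorphic_on {w. 0 < Re w}"
proof -
  have op: "open {w. 0 < Re w}" by (rule open_halfspace_Re_gt)
  have d: "(square_series (Suc j) b has_field_derivative - square_series j b w) (at w)" if "w \<in> {w. 0 < Re w}" for w
    using square_series_has_field_derivative[of b B, OF b] that by blast
  then have "square_series (Suc j) b holomorphic_on {w. 0 < Re w}"
    by (subst holomorphic_on_open[OF op]) blast
  then have "(\<lambda>w. - deriv (square_series (Suc j) b) w) holomorphic_on {w. 0 < Re w}"
    by (intro holomorphic_intros op)
  then show ?thesis
    by (rule holomorphic_transform) (simp add: DERIV_imp_deriv[OF d])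
qed

lemma square_series_periodic:
  assumes b: "\<And>k. norm (b k) \<le> B"
  shows "square_series j b (w + of_nat n * (2 * \<i>)) = square_series j b w"
proof -
  have "exp (- of_real (pi * real (Suc m) ^ 2) * (w + of_nat n * (2 * \<i>))) = exp (- of_real (pi * real (Suc m) ^ 2) * w)" for m
  proof -
    have "- of_real (pi * real (Suc m) ^ 2) * (w + of_nat n * (2 * \<i>))
        = - of_real (pi * real (Suc m) ^ 2) * w + of_real (of_int (2 * - (int n * (int (Suc m))\<^sup>2)) * pi) * \<i>"
      by (simp add: algebra_simps del: of_nat_Suc)
    then show ?thesis unfolding exp_eq by blast
  qed
  then show ?thesis by (simp only: square_series_def square_term_def)
qed

text \<open>
An absolutely convergent trigonometric series may be integrated term by term; several \<open>k n\<close> may coincide, and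
then their coefficients add up.
\<close>

lemma fourier_coeff_sums:
  fixes a :: "nat \<Rightarrow> complex" and k :: "nat \<Rightarrow> int"
  assumes a: "summable (\<lambda>n. norm (a n))"
  shows "(\<lambda>n. if k n = j then a n else 0) sums fourier_coeff (\<lambda>x. \<Sum>n. a n * cis (2 * pi * of_int (k n) * x)) j"
proof -
  define S where "S = (\<lambda>K x. \<Sum>n<K. a n * cis (2 * pi * of_int (k n) * x) * cis (- (2 * pi * of_int j * x)))"
  define T where "T = (\<lambda>x. \<Sum>n. a n * cis (2 * pi * of_int (k n) * x))"
  have summ: "summable (\<lambda>n. a n * cis (2 * pi * of_int (k n) * x))" for x
    by (rule summable_norm_cancel) (use a in \<open>simp add: norm_mult\<close>)
  have "uniform_limit (cbox (-1/2) (1/2)) S (\<lambda>x. \<Sum>n. a n * cis (2 * pi * of_int (k n) * x) * cis (- (2 * pi * of_int j * x))) sequentially"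
    unfolding S_def by (rule Weierstrass_m_test[OF _ a]) (simp add: norm_mult)
  also have "(\<lambda>x. \<Sum>n. a n * cis (2 * pi * of_int (k n) * x) * cis (- (2 * pi * of_int j * x)))
      = (\<lambda>x. T x * cis (- (2 * pi * of_int j * x)))"
    unfolding T_def by (intro ext suminf_mult2[symmetric] summ)
  finally have lim: "uniform_limit (cbox (-1/2) (1/2)) S (\<lambda>x. T x * cis (- (2 * pi * of_int j * x))) sequentially" .
  have cont: "continuous_on (cbox (-1/2) (1/2)) (S K)" for K
    unfolding S_def by (intro continuous_intros)
  from uniform_limit_integral_cbox[OF lim cont sequentially_bot]
  obtain I J where IJ: "\<And>K. (S K has_integral I K) {-1/2..1/2}"
      "((\<lambda>x. T x * cis (- (2 * pi * of_int j * x))) has_integral J) {-1/2..1/2}" "I \<longlonglongrightarrow> J"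
    unfolding box_real by blast
  have "I K = (\<Sum>n<K. if k n = j then a n else 0)" for K
  proof (rule has_integral_unique[OF IJ(1)])
    have "((\<lambda>x. \<Sum>n<K. a n * cis (2 * pi * of_int (k n - j) * x)) has_integral
        (\<Sum>n<K. a n * (if k n - j = 0 then 1 else 0))) {-1/2..1/2}"
      by (intro has_integral_sum has_integral_mult_right has_integral_cis_period) simp
    also have "(\<lambda>x. \<Sum>n<K. a n * cis (2 * pi * of_int (k n - j) * x)) = S K"
      unfolding S_def mult.assoc cis_mult by (simp add: algebra_simps)
    also have "(\<Sum>n<K. a n * (if k n - j = 0 then 1 else 0)) = (\<Sum>n<K. if k n = j then a n else 0)"
      by (intro sum.cong) auto
    finally show "(S K has_integral (\<Sum>n<K. if k n = j then a n else 0)) {-1/2..1/2}" .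
  qed
  then have "I = (\<lambda>K. \<Sum>n<K. if k n = j then a n else 0)" ..
  then have "(\<lambda>n. if k n = j then a n else 0) sums J"
    using IJ(3) unfolding sums_def by metis
  also have "J = fourier_coeff T j"
    unfolding fourier_coeff_def by (rule integral_unique[OF IJ(2), symmetric])
  finally show ?thesis by (simp add: T_def)
qed

text \<open>
On the imaginary axis, with the period normalised to 1, the series is a Fourier series whose frequencies \<open>- n\<^sup>2\<close> are all negative. If
its product with \<open>\<omega>\<close> is real there, it equals its complex conjugate, whose frequencies are all positive. Hence
the Fourier coefficient at \<open>- n\<^sup>2\<close> is zero.
\<close>

lemma square_series_real_on_imaginary_axis_imp_zero:
  assumes b: "\<And>k. norm (b k) \<le> B" and j: "j \<ge> 1" and om: "\<omega> \<noteq> 0"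
    and real: "\<And>u::real. Im (\<omega> * square_series j b (\<i> * of_real u)) = 0"
  shows "b (int (Suc m)) = 0"
proof -
  define a where "a = (\<lambda>n. \<omega> * (b (int (Suc n)) / of_real (pi * real (Suc n) ^ 2) ^ j))"
  define k where "k = (\<lambda>n. - (int (Suc n))\<^sup>2)"
  \<comment> \<open>The argument \<open>2 x\<close> normalises the period to 1.\<close>
  define S where "S = (\<lambda>x::real. \<omega> * square_series j b (\<i> * of_real (2 * x)))"
  have t0: "square_term j b 0 n = b (int (Suc n)) / of_real (pi * real (Suc n) ^ 2) ^ j" for n
    by (simp add: square_term_def)
  have "summable (\<lambda>n. norm (square_term j b 0 n))"
    by (rule summable_comparison_test'[OF summable_mult[OF summable_inverse_Suc_square], of 0 _ B])
       (use norm_square_term_le_closed[of b B 0 j, OF b _ j] in simp)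
  then have summ: "summable (\<lambda>n. norm (a n))"
    unfolding a_def t0[symmetric] norm_mult by (rule summable_mult)
  have sums: "(\<lambda>n. a n * cis (2 * pi * of_int (k n) * x)) sums S x" for x
  proof -
    have "(\<lambda>n. \<omega> * square_term j b (\<i> * of_real (2 * x)) n) sums S x"
      unfolding S_def by (intro sums_mult square_series_sums_closed[OF b _ j]) simp
    also have "(\<lambda>n. \<omega> * square_term j b (\<i> * of_real (2 * x)) n) = (\<lambda>n. a n * cis (2 * pi * of_int (k n) * x))"
    proof
      fix n
      have "exp (- of_real (pi * real (Suc n) ^ 2) * (\<i> * of_real (2 * x))) = cis (2 * pi * of_int (k n) * x)"
        unfolding cis_conv_exp k_def of_int_minus of_int_power of_int_of_nat_eq
        by (intro arg_cong[where f = exp]) (simp del: of_nat_Suc)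
      then show "\<omega> * square_term j b (\<i> * of_real (2 * x)) n = a n * cis (2 * pi * of_int (k n) * x)"
        by (simp only: square_term_def a_def mult.assoc)
    qed
    finally show ?thesis .
  qed
  then have S1: "S = (\<lambda>x. \<Sum>n. a n * cis (2 * pi * of_int (k n) * x))"
    by (auto simp: sums_iff)
  have "(\<lambda>n. cnj (a n) * cis (2 * pi * of_int (- k n) * x)) sums cnj (S x)" for x
    using sums_cnj[THEN iffD2, OF sums[of x]] by (simp add: cis_cnj)
  moreover have "cnj (S x) = S x" for x
    using real[of "2 * x"] by (simp add: S_def complex_eq_iff)
  ultimately have S2: "S = (\<lambda>x. \<Sum>n. cnj (a n) * cis (2 * pi * of_int (- k n) * x))"
    by (auto simp: sums_iff)
  have kinj: "k n = k m \<longleftrightarrow> n = m" for n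
  proof -
    have "k n = k m \<longleftrightarrow> (int (Suc n))\<^sup>2 = (int (Suc m))\<^sup>2" by (simp add: k_def)
    also have "\<dots> \<longleftrightarrow> int (Suc n) = int (Suc m)"
      by (rule power2_eq_iff_nonneg) auto
    finally show ?thesis by simp
  qed
  have kneg: "- k n \<noteq> k m" for n
  proof -
    have "(int (Suc n))\<^sup>2 > 0" "(int (Suc m))\<^sup>2 > 0" by simp_all
    then show ?thesis unfolding k_def by linarith
  qed
  have "(\<lambda>n. if n = m then a n else 0) sums fourier_coeff S (k m)"
    using fourier_coeff_sums[OF summ, of k "k m"] unfolding kinj S1[symmetric] .
  moreover have "(\<lambda>n. if n = m then a n else 0) sums a m" by (rule sums_single)
  ultimately have "fourier_coeff S (k m) = a m" by (rule sums_unique2)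
  moreover have "(\<lambda>n. 0) sums fourier_coeff S (k m)"
    using fourier_coeff_sums[of "\<lambda>n. cnj (a n)" "\<lambda>n. - k n" "k m"] summ kneg unfolding S2[symmetric] by simp
  ultimately have "a m = 0" using sums_unique2[OF _ sums_zero] by metis
  then show ?thesis using om by (simp add: a_def del: of_nat_Suc)
qed

section \<open>Periodic coefficients and their discrete Fourier transform\<close>

lemma has_sum_sum_finite:
  fixes f :: "'a \<Rightarrow> 'b \<Rightarrow> 'c::topological_comm_monoid_add"
  assumes "finite A" "\<And>a. a \<in> A \<Longrightarrow> (f a has_sum s a) B"
  shows "((\<lambda>x. \<Sum>a\<in>A. f a x) has_sum (\<Sum>a\<in>A. s a)) B"
  using assms by (induction A rule: finite_induct) (auto intro: has_sum_add)

text \<open>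
The sum over a period does not change when the residues are permuted, here by \<open>i\<close> with inverse \<open>j\<close>.
\<close>

lemma sum_period_reindex:
  fixes f :: "int \<Rightarrow> 'a::comm_monoid_add"
  assumes N: "N > 0" and per: "\<And>n. f (n mod N) = f n"
    and i: "\<And>n. i (j n mod N) mod N = n mod N" and j: "\<And>n. j (i n mod N) mod N = n mod N"
  shows "(\<Sum>a=0..<N. f (i a)) = (\<Sum>a=0..<N. f a)"
proof (rule sum.reindex_bij_witness[where i = "\<lambda>a. j a mod N" and j = "\<lambda>a. i a mod N"])
  fix a assume a: "a \<in> {0..<N}"
  show "j (i a mod N) mod N = a" "i (j a mod N) mod N = a" using i[of a] j[of a] a by auto
  show "f (i a mod N) = f (i a)" by (rule per)
qed (use N in auto)

lemma sum_period_shift: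
  fixes f :: "int \<Rightarrow> 'a::comm_monoid_add"
  assumes "N > 0" "\<And>n. f (n mod N) = f n"
  shows "(\<Sum>a=0..<N. f (a + s)) = (\<Sum>a=0..<N. f a)"
  by (rule sum_period_reindex[where j = "\<lambda>a. a - s"]) (use assms in \<open>auto simp: mod_simps\<close>)

lemma sum_period_uminus:
  fixes f :: "int \<Rightarrow> 'a::comm_monoid_add"
  assumes "N > 0" "\<And>n. f (n mod N) = f n"
  shows "(\<Sum>a=0..<N. f (- a)) = (\<Sum>a=0..<N. f a)"
  by (rule sum_period_reindex[where j = "\<lambda>a. - a"]) (use assms in \<open>auto simp: mod_simps\<close>)

text \<open>
Shifting the summation index multiplies the sum by the root of unity for \<open>k = 1\<close>; unless this is 1, the sum
vanishes.
\<close>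

lemma sum_roots_of_unity:
  fixes N d :: int
  assumes N: "N > 0"
  shows "(\<Sum>k=0..<N. cis (2 * pi * of_int (k * d) / of_int N)) = (if N dvd d then of_int N else 0)"
proof (cases "N dvd d")
  case True
  then obtain e where e: "d = N * e" by auto
  have "cis (2 * pi * of_int (k * d) / of_int N) = 1" for k
    using N by (intro trans[OF _ cis_multiple_2pi[of "of_int (k * e)"]] arg_cong[where f = cis]) (auto simp: e)
  then show ?thesis using True N by simp
next
  case False
  define f where "f = (\<lambda>k. cis (2 * pi * of_int (k * d) / of_int N))"
  define z where "z = cis (2 * pi * of_int d / of_int N)"
  have f1: "f (k + l) = f k * f l" for k l
    unfolding f_def cis_mult by (rule arg_cong[where f = cis]) (simp add: ring_distribs add_divide_distrib)
  have fN: "f (N * m) = 1" for m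
    using N unfolding f_def
    by (intro trans[OF _ cis_multiple_2pi[of "of_int (m * d)"]] arg_cong[where f = cis]) auto
  have per: "f (n mod N) = f n" for n
    using f1[of "n mod N" "N * (n div N)"] fN by (simp add: mod_mult_div_eq)
  have "(\<Sum>k=0..<N. f k) = (\<Sum>k=0..<N. f (k + 1))"
    by (rule sum_period_shift[of N f 1, symmetric, OF N per])
  also have "\<dots> = (\<Sum>k=0..<N. f k) * f 1"
    by (simp add: f1 sum_distrib_right)
  finally have "(\<Sum>k=0..<N. f k) * (f 1 - 1) = 0" by (simp add: algebra_simps)
  moreover have "f 1 \<noteq> 1"
  proof
    assume "f 1 = 1"
    then have "cos (2 * pi * of_int d / of_int N) = 1"
      by (simp add: f_def complex_eq_iff)
    then obtain n :: int where "2 * pi * of_int d / of_int N = of_int n * 2 * pi"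
      by (auto simp: cos_one_2pi_int)
    then have "real_of_int d = of_int (n * N)"
      using N by (simp add: field_simps)
    then have "d = n * N" by (simp only: of_int_eq_iff)
    with False show False by simp
  qed
  ultimately have "(\<Sum>k=0..<N. f k) = 0" by simp
  then show ?thesis using False by (simp add: f_def)
qed

text \<open>
Evenness allows series over all integers to be written as twice a series over the positive ones, and it is
inherited by the discrete Fourier transform.
\<close>

locale even_periodic =
  fixes N :: int and c :: "int \<Rightarrow> complex"
  assumes N: "N > 0" and periodic: "\<And>n. c (n mod N) = c n" and even: "\<And>n. c (- n) = c n"
begin

definition dft :: "int \<Rightarrow> complex" where
  "dft k = (\<Sum>a=0..<N. c a * cis (2 * pi * of_int (k * a) / of_int N))"

lemma cis_periodic: "cis (2 * pi * of_int (k * (a mod N)) / of_int N) = cis (2 * pi * of_int (k * a) / of_int N)"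
proof -
  have "k * a = k * (a mod N + N * (a div N))" by simp
  also have "\<dots> = k * (a mod N) + N * (k * (a div N))" by (simp only: distrib_left mult.left_commute)
  finally have "(of_int (k * a) :: real) = of_int (k * (a mod N)) + of_int N * of_int (k * (a div N))"
    by (simp only: of_int_add of_int_mult)
  then have "of_int (k * a) / of_int N = (of_int (k * (a mod N)) / of_int N + of_int (k * (a div N)) :: real)"
    using N by (simp only: add_divide_distrib) simp
  then have "cis (2 * pi * of_int (k * a) / of_int N)
      = cis (2 * pi * of_int (k * (a mod N)) / of_int N) * cis (2 * pi * of_int (k * (a div N)))"
    unfolding cis_mult by (intro arg_cong[where f = cis]) (simp only: times_divide_eq_right[symmetric] distrib_left)
  also have "cis (2 * pi * of_int (k * (a div N))) = 1" by (rule cis_multiple_2pi) (rule Ints_of_int)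
  finally show ?thesis by simp
qed

text \<open>
The transform satisfies the same assumptions, so that everything proved about \<open>c\<close> also applies to the dual side of
the reciprocity formula.
\<close>

lemma even_periodic_dft: "even_periodic N dft"
proof
  show "dft (n mod N) = dft n" for n
    unfolding dft_def using cis_periodic[of _ n] by (simp add: mult.commute)
  show "dft (- n) = dft n" for n
  proof -
    have "dft n = (\<Sum>a=0..<N. c (- a) * cis (2 * pi * of_int (n * - a) / of_int N))"
      unfolding dft_def
      by (rule sum_period_uminus[OF N, symmetric]) (simp only: periodic cis_periodic)
    then show ?thesis by (simp add: dft_def even)
  qed
qed (rule N)

lemma bounded: "norm (c n) \<le> (\<Sum>a=0..<N. norm (c a))"
proof -
  have "norm (c (n mod N)) \<le> (\<Sum>a=0..<N. norm (c a))"
    by (rule member_le_sum) (use N in auto)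
  then show ?thesis by (simp add: periodic)
qed

text \<open>
Fourier inversion at \<open>0\<close>.
\<close>

lemma sum_dft: "(\<Sum>k=0..<N. dft k) = of_int N * c 0"
proof -
  have "(\<Sum>k=0..<N. dft k) = (\<Sum>a=0..<N. c a * (\<Sum>k=0..<N. cis (2 * pi * of_int (k * a) / of_int N)))"
    unfolding dft_def by (subst sum.swap) (simp add: sum_distrib_left)
  also have "\<dots> = (\<Sum>a=0..<N. if a = 0 then c a * of_int N else 0)"
    unfolding sum_roots_of_unity[OF N] by (intro sum.cong) (auto simp: zdvd_not_zless)
  also have "\<dots> = of_int N * c 0" using N by simp
  finally show ?thesis .
qed

lemma square_series_has_sum_int:
  assumes w: "0 < Re w"
  shows "((\<lambda>n::int. c n * exp (- of_real (pi * of_int n ^ 2) * w)) has_sum (c 0 + 2 * square_series 0 c w)) UNIV"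
proof -
  define f where "f = (\<lambda>n::int. c n * exp (- of_real (pi * of_int n ^ 2) * w))"
  have eq: "f (int (Suc n)) = square_term 0 c w n" "f (- int (Suc n)) = square_term 0 c w n" for n
    unfolding f_def square_term_def even by (simp_all only: of_int_minus of_int_of_nat_eq power2_minus) simp_all
  have s: "(square_term 0 c w has_sum square_series 0 c w) UNIV"
    by (intro norm_summable_imp_has_sum summable_norm_square_term[OF bounded w] square_series_sums[OF bounded w])
  have "(f has_sum (f 0 + square_series 0 c w + square_series 0 c w)) UNIV"
    by (rule has_sum_int_split) (simp_all only: eq s)
  also have "f 0 + square_series 0 c w + square_series 0 c w = c 0 + 2 * square_series 0 c w"
    by (simp add: f_def)
  finally show ?thesis unfolding f_def .
qed

lemma has_sum_residue_classes:
  fixes f :: "int \<Rightarrow> complex"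
  assumes "\<And>a. a \<in> {0..<N} \<Longrightarrow> ((\<lambda>m. f (N * m + a)) has_sum s a) UNIV"
  shows "(f has_sum (\<Sum>a=0..<N. s a)) UNIV"
proof -
  have "(f has_sum s a) {n. n mod N = a}" if a: "a \<in> {0..<N}" for a
  proof -
    have "bij_betw (\<lambda>m. N * m + a) UNIV {n. n mod N = a}"
      by (rule bij_betw_byWitness[where f' = "\<lambda>n. n div N"]) (use a N in auto)
    then show ?thesis using has_sum_reindex_bij_betw[of _ UNIV _ f] assms[OF a] by blast
  qed
  then have "(f has_sum (\<Sum>a=0..<N. s a)) (\<Union>a\<in>{0..<N}. {n. n mod N = a})"
    by (intro sum_has_sum) auto
  also have "(\<Union>a\<in>{0..<N}. {n. n mod N = a}) = UNIV" using N by auto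
  finally show ?thesis .
qed

text \<open>
In the residue class of \<open>a\<close> the terms are Gaussians in \<open>m + a / N\<close>, so Poisson summation applies to each class
with shift \<open>a / N\<close>. The phases \<open>exp (2 \<pi> \<i> k a / N)\<close> it produces combine with the weights \<open>c a\<close> into the discrete
Fourier transform.
\<close>

lemma theta_reciprocity_real:
  fixes t :: real
  assumes t: "t > 0"
  shows "dft 0 + 2 * square_series 0 dft (1 / (of_int N ^ 2 * of_real t))
           = of_int N * of_real (sqrt t) * (c 0 + 2 * square_series 0 c (of_real t))"
proof -
  interpret dft: even_periodic N dft by (rule even_periodic_dft)
  \<comment> \<open>With this scaling, \<open>t (N m + a)\<^sup>2 = T (m + a / N)\<^sup>2\<close>.\<close>
  define T where "T = t * of_int N ^ 2"
  have T: "T > 0" "sqrt T = of_int N * sqrt t" using t N by (simp_all add: T_def real_sqrt_mult)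
  define S where "S = (\<Sum>a=0..<N. c a * theta_sum T (of_real (of_int a / of_int N)))"
  have "((\<lambda>n::int. c n * exp (- of_real (pi * of_int n ^ 2) * of_real t)) has_sum S) UNIV"
    unfolding S_def
  proof (rule has_sum_residue_classes)
    fix a
    have "((\<lambda>m::int. c a * exp (- of_real (pi * T) * (of_int m + of_real (of_int a / of_int N))\<^sup>2)) has_sum
             c a * theta_sum T (of_real (of_int a / of_int N))) UNIV"
      by (intro has_sum_cmult_right theta_sum_has_sum T)
    also have "(\<lambda>m::int. c a * exp (- of_real (pi * T) * (of_int m + of_real (of_int a / of_int N))\<^sup>2))
        = (\<lambda>m. c (N * m + a) * exp (- of_real (pi * of_int (N * m + a) ^ 2) * of_real t))"
    proof
      fix m
      have "c (N * m + a) = c a" by (metis periodic mod_mult_self4)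
      moreover have "of_real (pi * T) * (of_int m + of_real (of_int a / of_int N))\<^sup>2
          = (of_real (pi * of_int (N * m + a) ^ 2) * of_real t :: complex)"
        using N by (simp add: T_def field_simps power2_eq_square)
      ultimately show "c a * exp (- of_real (pi * T) * (of_int m + of_real (of_int a / of_int N))\<^sup>2)
        = c (N * m + a) * exp (- of_real (pi * of_int (N * m + a) ^ 2) * of_real t)"
        by (simp only: mult_minus_left)
    qed
    finally show "((\<lambda>m. c (N * m + a) * exp (- of_real (pi * of_int (N * m + a) ^ 2) * of_real t)) has_sum
        c a * theta_sum T (of_real (of_int a / of_int N))) UNIV" .
  qed
  moreover have "((\<lambda>n::int. c n * exp (- of_real (pi * of_int n ^ 2) * of_real t)) has_sum
      (c 0 + 2 * square_series 0 c (of_real t))) UNIV"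
    by (rule square_series_has_sum_int) (simp add: t)
  ultimately have S: "S = c 0 + 2 * square_series 0 c (of_real t)"
    by (rule has_sum_unique)
  have "((\<lambda>k::int. \<Sum>a=0..<N. c a * (cis (2 * pi * of_int k * (of_int a / of_int N)) * of_real (exp (- pi * of_int k ^ 2 / T))))
      has_sum (\<Sum>a=0..<N. c a * (of_real (sqrt T) * theta_sum T (of_real (of_int a / of_int N))))) UNIV"
    by (intro has_sum_sum_finite has_sum_cmult_right theta_sum_reciprocity T) simp
  also have "(\<Sum>a=0..<N. c a * (of_real (sqrt T) * theta_sum T (of_real (of_int a / of_int N)))) = of_real (sqrt T) * S"
    by (simp add: S_def sum_distrib_left mult_ac)
  also have "(\<lambda>k::int. \<Sum>a=0..<N. c a * (cis (2 * pi * of_int k * (of_int a / of_int N)) * of_real (exp (- pi * of_int k ^ 2 / T))))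
      = (\<lambda>k. dft k * exp (- of_real (pi * of_int k ^ 2) * (1 / (of_int N ^ 2 * of_real t))))"
  proof
    fix k :: int
    have "of_real (exp (- pi * of_int k ^ 2 / T)) = exp (- of_real (pi * of_int k ^ 2) * (1 / (of_int N ^ 2 * of_real t)) :: complex)"
      unfolding exp_of_real[symmetric] by (intro arg_cong[where f = exp]) (simp add: T_def mult.commute)
    then show "(\<Sum>a=0..<N. c a * (cis (2 * pi * of_int k * (of_int a / of_int N)) * of_real (exp (- pi * of_int k ^ 2 / T))))
      = dft k * exp (- of_real (pi * of_int k ^ 2) * (1 / (of_int N ^ 2 * of_real t)))"
      by (simp only: dft_def sum_distrib_right) (intro sum.cong refl, simp add: mult_ac)
  qed
  finally have "((\<lambda>k. dft k * exp (- of_real (pi * of_int k ^ 2) * (1 / (of_int N ^ 2 * of_real t)))) has_sum of_real (sqrt T) * S) UNIV" .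
  moreover have "((\<lambda>k. dft k * exp (- of_real (pi * of_int k ^ 2) * (1 / (of_int N ^ 2 * of_real t)))) has_sum
      (dft 0 + 2 * square_series 0 dft (1 / (of_int N ^ 2 * of_real t)))) UNIV"
  proof (rule dft.square_series_has_sum_int)
    have "1 / (of_int N ^ 2 * of_real t) = (of_real (1 / (of_int N ^ 2 * t)) :: complex)" by simp
    then show "0 < Re (1 / (of_int N ^ 2 * of_real t))"
      unfolding \<open>1 / (of_int N ^ 2 * of_real t) = _\<close> Re_complex_of_real using t N by simp
  qed
  ultimately have "of_real (sqrt T) * S = dft 0 + 2 * square_series 0 dft (1 / (of_int N ^ 2 * of_real t))"
    by (rule has_sum_unique)
  then show ?thesis by (simp add: S T(2))
qed

lemma Re_inverse_pos:
  assumes "0 < Re z"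
  shows "0 < Re (1 / (of_int N ^ 2 * z))"
proof -
  have "Re (1 / (of_int N ^ 2 * z)) = Re (1 / z) / of_int N ^ 2"
    by (metis Re_divide_of_real divide_divide_eq_left' of_real_of_int_eq of_real_power)
  also have "\<dots> > 0" using assms N by (intro divide_pos_pos) (auto simp: Re_divide intro!: divide_pos_pos add_pos_nonneg)
  finally show ?thesis .
qed

text \<open>
Both sides are holomorphic in the right half plane and agree on the positive real axis.
\<close>

lemma theta_reciprocity:
  assumes z: "0 < Re z"
  shows "dft 0 + 2 * square_series 0 dft (1 / (of_int N ^ 2 * z))
           = of_int N * csqrt z * (c 0 + 2 * square_series 0 c z)"
proof -
  interpret dft: even_periodic N dft by (rule even_periodic_dft)
  define D where "D = (\<lambda>z. dft 0 + 2 * square_series 0 dft (1 / (of_int N ^ 2 * z))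
      - of_int N * csqrt z * (c 0 + 2 * square_series 0 c z))"
  have sub: "z \<notin> \<real>\<^sub>\<le>\<^sub>0" if "0 < Re z" for z
    using that by (auto simp: complex_nonpos_Reals_iff)
  have hd: "square_series 0 dft holomorphic_on {w. 0 < Re w}" by (rule square_series_holomorphic[OF dft.bounded])
  have hc: "square_series 0 c holomorphic_on {w. 0 < Re w}" by (rule square_series_holomorphic[OF bounded])
  have "(\<lambda>z. square_series 0 dft (1 / (of_int N ^ 2 * z))) holomorphic_on {w. 0 < Re w}"
    by (rule holomorphic_on_compose_gen[OF _ hd, unfolded o_def])
       (use N in \<open>auto intro!: holomorphic_intros Re_inverse_pos\<close>)
  then have "D holomorphic_on {w. 0 < Re w}"
    unfolding D_def by (intro holomorphic_intros hc) (auto simp: sub)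
  moreover have "open {w. 0 < Re w}" by (rule open_halfspace_Re_gt)
  moreover have "connected {w. 0 < Re w}" by (intro convex_connected convex_halfspace_Re_gt)
  moreover have "of_real ` {0<..} \<subseteq> {w. 0 < Re w}" by auto
  moreover have "(1::complex) \<in> {w. 0 < Re w}" by simp
  moreover have "(1::complex) islimpt of_real ` {0<..}"
  proof (rule islimpt_approachable[THEN iffD2], intro allI impI)
    fix e :: real assume "e > 0"
    then show "\<exists>x'\<in>of_real ` {0<..}. x' \<noteq> 1 \<and> dist x' (1::complex) < e"
      by (intro bexI[OF _ imageI[of "1 + e / 2"]]) (auto simp: dist_norm norm_divide)
  qed
  moreover have "D z = 0" if "z \<in> of_real ` {0<..}" for z
    using that theta_reciprocity_real by (auto simp: D_def csqrt_of_real)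
  moreover have "z \<in> {w. 0 < Re w}" using z by simp
  ultimately have "D z = 0" by (rule analytic_continuation)
  then show ?thesis by (simp add: D_def)
qed

section \<open>Expansion at the boundary point\<close>

text \<open>
The error in the expansion of \<open>square_series 1 c\<close> at \<open>0\<close>. The coefficients of the two dual series are those of
repeated integration by parts: in the derivative, the series of index 0 from \<open>theta_reciprocity\<close> cancels
against the derivative of the dual series of index 1, and the terms of index 1 cancel in the same way.
\<close>

definition remainder :: "complex \<Rightarrow> complex" where
  "remainder z = square_series 1 c z - square_series 1 c 0 - c 0 / 2 * z + dft 0 / of_int N * csqrt z
     + of_int N * (z * csqrt z) * square_series 1 dft (1 / (of_int N ^ 2 * z))
     - 3 / 2 * of_int N ^ 3 * (z\<^sup>2 * csqrt z) * square_series 2 dft (1 / (of_int N ^ 2 * z))"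

lemma square_series_dft_has_field_derivative:
  assumes z: "0 < Re z"
  shows "((\<lambda>z. square_series (Suc j) dft (1 / (of_int N ^ 2 * z))) has_field_derivative
           square_series j dft (1 / (of_int N ^ 2 * z)) / (of_int N ^ 2 * z\<^sup>2)) (at z)"
proof -
  interpret dft: even_periodic N dft by (rule even_periodic_dft)
  have z0: "z \<noteq> 0" using z by auto
  have "((\<lambda>z. 1 / (of_int N ^ 2 * z)) has_field_derivative - 1 / (of_int N ^ 2 * z\<^sup>2)) (at z)"
    using N z0 by (auto intro!: derivative_eq_intros simp: power2_eq_square)
  from DERIV_chain2[OF square_series_has_field_derivative[OF dft.bounded Re_inverse_pos[OF z]] this, of j]
  show ?thesis by simp
qed

text \<open>
All terms of lower order cancel, and the derivative is \<open>O(|z| \<surd>|z|)\<close>. After integration the remainder is of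
smaller order than the oscillating term \<open>z \<surd>z S\<^sub>1(d, 1 / (N\<^sup>2 z))\<close>; without the dual series of index 2 the bound
would only be of the same order.
\<close>

lemma remainder_has_field_derivative:
  assumes z: "0 < Re z"
  shows "(remainder has_field_derivative
           - (15 / 4) * of_int N ^ 3 * (z * csqrt z) * square_series 2 dft (1 / (of_int N ^ 2 * z))) (at z)"
proof -
  have z': "z \<notin> \<real>\<^sub>\<le>\<^sub>0" "z \<noteq> 0" using z by (auto simp: complex_nonpos_Reals_iff)
  define s where "s = csqrt z"
  define n where "n = (of_int N :: complex)"
  define l where "l = (\<lambda>j. square_series j dft (1 / (n ^ 2 * z)))"
  have s: "s \<noteq> 0" "z = s\<^sup>2" using z' by (simp_all add: s_def)
  have n: "n \<noteq> 0" using N by (simp add: n_def)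
  \<comment> \<open>In terms of \<open>s\<close> and \<open>n\<close> the cancellation below is an identity of rational functions.\<close>
  have th: "square_series 0 c z = (dft 0 + 2 * l 0) / (2 * n * s) - c 0 / 2"
  proof -
    have "(dft 0 + 2 * l 0) / (2 * n * s) = (c 0 + 2 * square_series 0 c z) / 2"
      using theta_reciprocity[OF z] n s(1) by (simp add: l_def n_def s_def)
    then show ?thesis by (simp add: field_simps)
  qed
  have d1: "(square_series 1 c has_field_derivative - square_series 0 c z) (at z)"
    using square_series_has_field_derivative[OF bounded z, of 0] by simp
  have d2: "((\<lambda>z. square_series 1 dft (1 / (n ^ 2 * z))) has_field_derivative l 0 / (n ^ 2 * z\<^sup>2)) (at z)"
    using square_series_dft_has_field_derivative[OF z, of 0] by (simp add: l_def n_def)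
  have d3: "((\<lambda>z. square_series 2 dft (1 / (n ^ 2 * z))) has_field_derivative l 1 / (n ^ 2 * z\<^sup>2)) (at z)"
    using square_series_dft_has_field_derivative[OF z, of 1] by (simp add: l_def n_def numeral_2_eq_2)
  have d4: "(csqrt has_field_derivative 1 / (2 * s)) (at z)"
    using has_field_derivative_csqrt[OF z'(1)] by (simp add: s_def field_simps)
  have "((\<lambda>z. square_series 1 c z - square_series 1 c 0 - c 0 / 2 * z + dft 0 / n * csqrt z
     + n * (z * csqrt z) * square_series 1 dft (1 / (n ^ 2 * z))
     - 3 / 2 * n ^ 3 * (z\<^sup>2 * csqrt z) * square_series 2 dft (1 / (n ^ 2 * z))) has_field_derivative
      (- square_series 0 c z - 0 - c 0 / 2 * 1 + dft 0 / n * (1 / (2 * s))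
     + (n * (1 * s + 1 / (2 * s) * z) * l 1 + l 0 / (n ^ 2 * z\<^sup>2) * (n * (z * s)))
     - (3 / 2 * n ^ 3 * (2 * z * s + 1 / (2 * s) * z\<^sup>2) * l 2 + l 1 / (n ^ 2 * z\<^sup>2) * (3 / 2 * n ^ 3 * (z\<^sup>2 * s))))) (at z)"
    by (rule derivative_eq_intros d1 d2 d3 d4 refl)+ (simp add: l_def s_def algebra_simps)
  also have "(- square_series 0 c z - 0 - c 0 / 2 * 1 + dft 0 / n * (1 / (2 * s))
     + (n * (1 * s + 1 / (2 * s) * z) * l 1 + l 0 / (n ^ 2 * z\<^sup>2) * (n * (z * s)))
     - (3 / 2 * n ^ 3 * (2 * z * s + 1 / (2 * s) * z\<^sup>2) * l 2 + l 1 / (n ^ 2 * z\<^sup>2) * (3 / 2 * n ^ 3 * (z\<^sup>2 * s))))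
    = - (15 / 4) * n ^ 3 * (z * s) * l 2"
    unfolding th using n s(1) unfolding s(2) by (simp add: field_simps power2_eq_square power3_eq_cube)
  finally show ?thesis
    unfolding remainder_def[abs_def] l_def n_def s_def .
qed

lemma Re_inverse_nonneg:
  assumes "0 \<le> Re z"
  shows "0 \<le> Re (1 / (of_int N ^ 2 * z))"
proof -
  have "Re (1 / (of_int N ^ 2 * z)) = Re (1 / z) / of_int N ^ 2"
    by (metis Re_divide_of_real divide_divide_eq_left' of_real_of_int_eq of_real_power)
  also have "\<dots> \<ge> 0" using assms by (auto simp: Re_divide)
  finally show ?thesis .
qed

text \<open>
A common bound for the dual series of index at least 1 on the closed half plane, where their argument \<open>1 / (N\<^sup>2 z)\<close> is unbounded
as \<open>z\<close> tends to \<open>0\<close>.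
\<close>

definition majorant :: real where
  "majorant = (\<Sum>a=0..<N. norm (dft a)) * (\<Sum>n. 1 / real (Suc n) ^ 2)"

lemma norm_square_series_dft_le:
  assumes "0 \<le> Re w" "j \<ge> 1"
  shows "norm (square_series j dft w) \<le> majorant"
proof -
  interpret dft: even_periodic N dft by (rule even_periodic_dft)
  show ?thesis unfolding majorant_def by (rule norm_square_series_le[OF dft.bounded assms])
qed

lemma majorant_nonneg: "majorant \<ge> 0"
  using norm_square_series_dft_le[of 0 1] by (auto intro: order_trans[OF norm_ge_zero])

lemma remainder_tendsto_0:
  assumes z: "0 \<le> Re z"
  shows "((\<lambda>d. remainder (of_real d * z)) \<longlongrightarrow> 0) (at_right 0)"
proof -
  have lim: "((\<lambda>d. of_real d * z) \<longlongrightarrow> 0) (at_right 0)"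
    by (auto intro!: tendsto_eq_intros)
  have ev: "\<forall>\<^sub>F d in at_right 0. 0 \<le> Re (of_real d * z)"
    using z by (auto simp: eventually_at_filter)
  have sq: "((\<lambda>d. csqrt (of_real d * z)) \<longlongrightarrow> 0) (at_right 0)"
    by (rule tendsto_norm_zero_cancel) (use tendsto_real_sqrt[OF tendsto_norm_zero[OF lim]] in simp)
  have bnd: "((\<lambda>d. square_series j dft (1 / (of_int N ^ 2 * (of_real d * z))) * f d) \<longlongrightarrow> 0) (at_right 0)"
    if "j \<ge> 1" and f: "(f \<longlongrightarrow> 0) (at_right 0)" for j and f :: "real \<Rightarrow> complex"
  proof (rule Lim_null_comparison)
    show "((\<lambda>d. majorant * norm (f d)) \<longlongrightarrow> 0) (at_right 0)"
      using tendsto_mult_left[OF tendsto_norm_zero[OF f], of majorant] by simp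
    show "\<forall>\<^sub>F d in at_right 0. norm (square_series j dft (1 / (of_int N ^ 2 * (of_real d * z))) * f d) \<le> majorant * norm (f d)"
      using ev unfolding norm_mult
      by eventually_elim (intro mult_right_mono norm_square_series_dft_le Re_inverse_nonneg that norm_ge_zero)
  qed
  have L: "((\<lambda>d. square_series 1 c (of_real d * z)) \<longlongrightarrow> square_series 1 c 0) (at_right 0)"
    by (rule continuous_on_tendsto_compose[OF square_series_continuous[OF bounded] lim]) (use ev in auto)
  have "((\<lambda>d. square_series 1 c (of_real d * z) - square_series 1 c 0 - c 0 / 2 * (of_real d * z) + dft 0 / of_int N * csqrt (of_real d * z)
     + square_series 1 dft (1 / (of_int N ^ 2 * (of_real d * z))) * (of_int N * ((of_real d * z) * csqrt (of_real d * z)))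
     - square_series 2 dft (1 / (of_int N ^ 2 * (of_real d * z))) * (3 / 2 * of_int N ^ 3 * ((of_real d * z)\<^sup>2 * csqrt (of_real d * z))))
     \<longlongrightarrow> square_series 1 c 0 - square_series 1 c 0 - c 0 / 2 * 0 + dft 0 / of_int N * 0 + 0 - 0) (at_right 0)"
    using tendsto_power[OF lim, of 2]
    by (intro tendsto_intros L lim sq bnd tendsto_mult_right_zero tendsto_mult_zero) simp_all
  then show ?thesis
    by (simp add: remainder_def mult_ac)
qed

text \<open>
The mean value inequality on the segment from \<open>d z\<close> to \<open>z\<close>, followed by \<open>d \<longlonglongrightarrow> 0\<close>. The segment stays in the open half
plane, where the derivative is known.
\<close>

lemma norm_remainder_le_open:
  assumes z: "0 < Re z"
  shows "norm (remainder z) \<le> 15 / 4 * of_int N ^ 3 * majorant * (norm z ^ 2 * sqrt (norm z))"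
proof -
  define S where "S = {w. 0 < Re w} \<inter> cball 0 (norm z)"
  define B where "B = 15 / 4 * of_int N ^ 3 * majorant * (norm z * sqrt (norm z))"
  have B: "B \<ge> 0" using majorant_nonneg N by (auto simp: B_def intro!: mult_nonneg_nonneg)
  have "norm (remainder z - remainder (of_real d * z)) \<le> B * norm (z - of_real d * z)" if "d \<in> {0<..<1}" for d :: real
  proof (rule field_differentiable_bound[where S = S])
    show "convex S" unfolding S_def by (intro convex_Int convex_halfspace_Re_gt convex_cball)
    show "z \<in> S" using z by (auto simp: S_def)
    have "d * norm z \<le> 1 * norm z" using that by (intro mult_right_mono) auto
    then show "of_real d * z \<in> S" using that z by (auto simp: S_def norm_mult)
  next
    fix w assume w: "w \<in> S"
    then have "0 < Re w" by (simp add: S_def)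
    then show "(remainder has_field_derivative
           - (15 / 4) * of_int N ^ 3 * (w * csqrt w) * square_series 2 dft (1 / (of_int N ^ 2 * w))) (at w within S)"
      by (rule has_field_derivative_at_within[OF remainder_has_field_derivative])
    have "norm (- (15 / 4) * of_int N ^ 3 * (w * csqrt w) * square_series 2 dft (1 / (of_int N ^ 2 * w)))
        = 15 / 4 * of_int N ^ 3 * (norm w * sqrt (norm w)) * norm (square_series 2 dft (1 / (of_int N ^ 2 * w)))"
      using N by (simp add: norm_mult norm_power)
    also have "\<dots> \<le> 15 / 4 * of_int N ^ 3 * (norm z * sqrt (norm z)) * majorant"
      using w N by (intro mult_mono norm_square_series_dft_le Re_inverse_nonneg mult_nonneg_nonneg) (auto simp: S_def)
    finally show "norm (- (15 / 4) * of_int N ^ 3 * (w * csqrt w) * square_series 2 dft (1 / (of_int N ^ 2 * w))) \<le> B"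
      by (simp add: B_def mult_ac)
  qed
  moreover have "norm (z - of_real d * z) \<le> norm z" if "d \<in> {0<..<1}" for d :: real
  proof -
    have "z - of_real d * z = of_real (1 - d) * z" by (simp add: algebra_simps)
    then have "norm (z - of_real d * z) = \<bar>1 - d\<bar> * norm z" by (simp only: norm_mult norm_of_real)
    also have "\<dots> \<le> 1 * norm z" using that by (intro mult_right_mono) auto
    finally show ?thesis by simp
  qed
  ultimately have *: "norm (remainder z - remainder (of_real d * z)) \<le> B * norm z" if "d \<in> {0<..<1}" for d :: real
    using that B by (meson mult_left_mono order_trans)
  have "norm (remainder z - 0) \<le> B * norm z"
  proof (rule tendsto_upperbound)
    show "((\<lambda>d. norm (remainder z - remainder (of_real d * z))) \<longlongrightarrow> norm (remainder z - 0)) (at_right 0)"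
      using z by (intro tendsto_intros remainder_tendsto_0) simp
    show "\<forall>\<^sub>F d in at_right 0. norm (remainder z - remainder (of_real d * z)) \<le> B * norm z"
      using eventually_at_right_real[of 0 1] by (auto elim!: eventually_mono intro: *)
  qed simp
  then show ?thesis by (simp add: B_def power2_eq_square mult_ac)
qed

text \<open>
The bound passes to the imaginary axis by continuity along \<open>z + d\<close>.
\<close>

lemma norm_remainder_le:
  assumes z: "0 \<le> Re z" "z \<noteq> 0"
  shows "norm (remainder z) \<le> 15 / 4 * of_int N ^ 3 * majorant * (norm z ^ 2 * sqrt (norm z))"
proof -
  interpret dft: even_periodic N dft by (rule even_periodic_dft)
  define S where "S = {w. 0 \<le> Re w} - {0}"
  have dual: "continuous_on S (\<lambda>z. square_series j dft (1 / (of_int N ^ 2 * z)))" if "j \<ge> 1" for j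
    by (rule continuous_on_compose2[OF square_series_continuous[OF dft.bounded that]])
       (use N in \<open>auto simp: S_def intro!: continuous_intros Re_inverse_nonneg\<close>)
  have csq: "continuous_on S csqrt"
    by (rule continuous_on_subset[OF continuous_on_csqrt])
       (auto simp: S_def complex_nonpos_Reals_iff complex_eq_iff)
  have cont: "continuous_on S remainder"
    unfolding remainder_def[abs_def]
    by (intro continuous_intros dual csq continuous_on_subset[OF square_series_continuous[OF bounded]])
       (auto simp: S_def)
  have lim: "((\<lambda>d. z + of_real d) \<longlongrightarrow> z) (at_right 0)"
    by (auto intro!: tendsto_eq_intros)
  have "z + of_real d \<in> S" if "d > 0" for d
  proof -
    have "0 < Re (z + of_real d)" using z that by simp
    moreover from this have "z + of_real d \<noteq> 0" by (metis less_irrefl zero_complex.sel(1))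
    ultimately show ?thesis by (simp add: S_def)
  qed
  then have ev: "\<forall>\<^sub>F d in at_right 0. z + of_real d \<in> S"
    by (auto simp: eventually_at_filter)
  have "z \<in> S" using z by (simp add: S_def)
  from continuous_on_tendsto_compose[OF cont lim this ev]
  have "((\<lambda>d. remainder (z + of_real d)) \<longlongrightarrow> remainder z) (at_right 0)" .
  from tendsto_norm[OF this] show ?thesis
  proof (rule tendsto_le[OF trivial_limit_at_right_real, rotated])
    show "((\<lambda>d. 15 / 4 * of_int N ^ 3 * majorant * (norm (z + of_real d) ^ 2 * sqrt (norm (z + of_real d)))) \<longlongrightarrow>
        15 / 4 * of_int N ^ 3 * majorant * (norm z ^ 2 * sqrt (norm z))) (at_right 0)"
      by (intro tendsto_intros lim)
    have "0 < Re (z + of_real d)" if "d > 0" for d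
      using z that by simp
    then show "\<forall>\<^sub>F d in at_right 0. norm (remainder (z + of_real d)) \<le>
        15 / 4 * of_int N ^ 3 * majorant * (norm (z + of_real d) ^ 2 * sqrt (norm (z + of_real d)))"
      unfolding eventually_at_filter by (intro always_eventually allI impI norm_remainder_le_open) simp
  qed
qed

end

section \<open>Hoelder exponents from linear approximations\<close>

lemma tendsto_abs_powr_0:
  fixes e :: real
  assumes "e > 0"
  shows "((\<lambda>h::real. \<bar>h\<bar> powr e) \<longlongrightarrow> 0) (at 0)"
proof -
  have "((\<lambda>h::real. \<bar>h\<bar>) \<longlongrightarrow> 0) (at 0)" by (auto intro!: tendsto_eq_intros)
  then show ?thesis using assms by (intro tendsto_zero_powrI[where b = e]) auto
qed

lemma tendsto_quotient_powr:
  fixes g :: "real \<Rightarrow> real"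
  assumes g: "\<And>h. h \<noteq> 0 \<Longrightarrow> \<bar>g h\<bar> \<le> K * \<bar>h\<bar> powr \<gamma>" and "\<beta> < \<gamma>"
  shows "((\<lambda>h. g h / \<bar>h\<bar> powr \<beta>) \<longlongrightarrow> 0) (at 0)"
proof (rule Lim_null_comparison)
  show "((\<lambda>h. K * \<bar>h\<bar> powr (\<gamma> - \<beta>)) \<longlongrightarrow> 0) (at 0)"
    using tendsto_mult_left[OF tendsto_abs_powr_0[of "\<gamma> - \<beta>"], of K] assms(2) by simp
  have "norm (g h / \<bar>h\<bar> powr \<beta>) \<le> K * \<bar>h\<bar> powr (\<gamma> - \<beta>)" if "h \<noteq> 0" for h
  proof -
    have "\<bar>g h\<bar> / \<bar>h\<bar> powr \<beta> \<le> K * \<bar>h\<bar> powr \<gamma> / \<bar>h\<bar> powr \<beta>"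
      by (intro divide_right_mono g that) simp
    then show ?thesis by (simp add: powr_diff abs_divide)
  qed
  then show "\<forall>\<^sub>F h in at 0. norm (g h / \<bar>h\<bar> powr \<beta>) \<le> K * \<bar>h\<bar> powr (\<gamma> - \<beta>)"
    by (auto simp: eventually_at_filter)
qed

text \<open>
The square roots of the expansion in the form in which Hoelder exponents are stated.
\<close>

lemma sqrt_abs_powr: "sqrt \<bar>h\<bar> = \<bar>h\<bar> powr (1/2)" "\<bar>h\<bar> * sqrt \<bar>h\<bar> = \<bar>h\<bar> powr (3/2)"
  "\<bar>h\<bar>\<^sup>2 * sqrt \<bar>h\<bar> = \<bar>h\<bar> powr (5/2)"
proof -
  show 1: "sqrt \<bar>h\<bar> = \<bar>h\<bar> powr (1/2)" by (simp add: powr_half_sqrt)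
  have "\<bar>h\<bar> * \<bar>h\<bar> powr (1/2) = \<bar>h\<bar> powr (1 + 1/2)"
    by (subst powr_add) simp
  then show "\<bar>h\<bar> * sqrt \<bar>h\<bar> = \<bar>h\<bar> powr (3/2)" by (simp add: 1)
  have "\<bar>h\<bar>\<^sup>2 * \<bar>h\<bar> powr (1/2) = \<bar>h\<bar> powr (2 + 1/2)"
    by (subst powr_add) (cases "h = 0"; simp)
  then show "\<bar>h\<bar>\<^sup>2 * sqrt \<bar>h\<bar> = \<bar>h\<bar> powr (5/2)" by (simp add: 1)
qed

lemma powr_mono_near_0:
  fixes h :: real
  assumes "\<bar>h\<bar> \<le> 1" "a \<le> b"
  shows "\<bar>h\<bar> powr b \<le> \<bar>h\<bar> powr a"
  using assms by (intro powr_mono') auto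

lemma eventually_abs_le_1: "\<forall>\<^sub>F h in at (0::real). \<bar>h\<bar> \<le> 1 \<and> h \<noteq> 0"
proof -
  have "\<bar>h\<bar> \<le> 1" if "dist h 0 < 1" for h :: real
    using that by simp
  then show ?thesis unfolding eventually_at by (intro exI[of _ 1]) auto
qed

text \<open>
Below order 2 only the constant and the linear term of the Hoelder polynomial matter. Its constant term is
\<open>F x\<close>, because the defining estimate is required at \<open>h = 0\<close> too.
\<close>

lemma holder_at_imp_linear_approx:
  assumes hol: "holder_at F x \<alpha>" and \<beta>: "\<beta> < \<alpha>" "\<beta> < 2"
  obtains a where "((\<lambda>h. (F (x + h) - F x - a * h) / \<bar>h\<bar> powr \<beta>) \<longlongrightarrow> 0) (at 0)"
proof -
  obtain P where P: "(\<lambda>h. F (x + h) - poly P h) \<in> O[nhds 0](\<lambda>h. \<bar>h\<bar> powr \<alpha>)"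
    using hol by (auto simp: holder_at_def)
  obtain p0 p1 Q where PQ: "P = pCons p0 (pCons p1 Q)"
    by (metis pCons_cases)
  obtain C where C: "C > 0" "\<forall>\<^sub>F h in nhds 0. norm (F (x + h) - poly P h) \<le> C * norm (\<bar>h\<bar> powr \<alpha>)"
    using landau_o.bigE[OF P] by blast
  have p0: "F x = p0"
    using eventually_nhds_x_imp_x[OF C(2)] by (simp add: PQ)
  have "((\<lambda>h. (F (x + h) - F x - p1 * h) / \<bar>h\<bar> powr \<beta>) \<longlongrightarrow> 0) (at 0)"
  proof (rule Lim_null_comparison)
    have "((\<lambda>h. C * \<bar>h\<bar> powr (\<alpha> - \<beta>) + \<bar>h\<bar> powr (2 - \<beta>) * \<bar>poly Q h\<bar>) \<longlongrightarrow> C * 0 + 0 * \<bar>poly Q 0\<bar>) (at 0)"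
      using \<beta> by (intro tendsto_intros tendsto_abs_powr_0) (auto intro!: poly_isCont[THEN isContD])
    then show "((\<lambda>h. C * \<bar>h\<bar> powr (\<alpha> - \<beta>) + \<bar>h\<bar> powr (2 - \<beta>) * \<bar>poly Q h\<bar>) \<longlongrightarrow> 0) (at 0)" by simp
    have "\<forall>\<^sub>F h in at 0. norm (F (x + h) - poly P h) \<le> C * norm (\<bar>h\<bar> powr \<alpha>) \<and> h \<noteq> 0"
      using C(2) by (auto simp: eventually_at_filter elim: eventually_mono)
    then show "\<forall>\<^sub>F h in at 0. norm ((F (x + h) - F x - p1 * h) / \<bar>h\<bar> powr \<beta>)
        \<le> C * \<bar>h\<bar> powr (\<alpha> - \<beta>) + \<bar>h\<bar> powr (2 - \<beta>) * \<bar>poly Q h\<bar>"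
    proof eventually_elim
      case (elim h)
      have "F (x + h) - F x - p1 * h = (F (x + h) - poly P h) + h\<^sup>2 * poly Q h"
        by (simp add: PQ p0 algebra_simps power2_eq_square)
      moreover have "\<bar>F (x + h) - poly P h\<bar> \<le> C * \<bar>h\<bar> powr \<alpha>" using elim by simp
      moreover have "\<bar>h\<^sup>2 * poly Q h\<bar> = \<bar>h\<bar>\<^sup>2 * \<bar>poly Q h\<bar>" by (simp add: abs_mult)
      ultimately have "\<bar>F (x + h) - F x - p1 * h\<bar> \<le> C * \<bar>h\<bar> powr \<alpha> + \<bar>h\<bar>\<^sup>2 * \<bar>poly Q h\<bar>"
        using abs_triangle_ineq[of "F (x + h) - poly P h" "h\<^sup>2 * poly Q h"] by linarith
      then have "\<bar>F (x + h) - F x - p1 * h\<bar> / \<bar>h\<bar> powr \<beta> \<le> (C * \<bar>h\<bar> powr \<alpha> + \<bar>h\<bar>\<^sup>2 * \<bar>poly Q h\<bar>) / \<bar>h\<bar> powr \<beta>"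
        by (intro divide_right_mono) auto
      also have "\<bar>h\<bar>\<^sup>2 = \<bar>h\<bar> powr 2" using elim by simp
      also have "(C * \<bar>h\<bar> powr \<alpha> + \<bar>h\<bar> powr 2 * \<bar>poly Q h\<bar>) / \<bar>h\<bar> powr \<beta>
          = C * \<bar>h\<bar> powr (\<alpha> - \<beta>) + \<bar>h\<bar> powr (2 - \<beta>) * \<bar>poly Q h\<bar>"
        by (simp add: powr_diff add_divide_distrib)
      finally show ?case by (simp add: abs_divide)
    qed
  qed
  then show ?thesis by (rule that)
qed

lemma holder_at_linear_approxI:
  assumes "\<forall>\<^sub>F h in at 0. \<bar>F (x + h) - F x - a * h\<bar> \<le> K * \<bar>h\<bar> powr \<beta>"
  shows "holder_at F x \<beta>"
  unfolding holder_at_def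
proof (intro exI[of _ "[:F x, a:]"] landau_o.bigI)
  show "max K 1 > 0" by simp
  have "\<bar>F (x + h) - (F x + h * a)\<bar> \<le> max K 1 * \<bar>h\<bar> powr \<beta>"
    if "\<bar>F (x + h) - F x - a * h\<bar> \<le> K * \<bar>h\<bar> powr \<beta>" for h
  proof -
    have "K * \<bar>h\<bar> powr \<beta> \<le> max K 1 * \<bar>h\<bar> powr \<beta>" by (intro mult_right_mono) auto
    then show ?thesis using that by (simp add: algebra_simps)
  qed
  then show "\<forall>\<^sub>F h in nhds 0. norm (F (x + h) - poly [:F x, a:] h) \<le> max K 1 * norm (\<bar>h\<bar> powr \<beta>)"
    using assms unfolding eventually_at_filter by (auto elim!: eventually_mono)
qed

lemma holder_exponent_eqI:
  assumes "\<beta> > 0" "holder_at F x \<beta>" "\<And>\<alpha>. \<alpha> > \<beta> \<Longrightarrow> \<not> holder_at F x \<alpha>"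
  shows "holder_exponent F x = ennreal \<beta>"
  unfolding holder_exponent_def
proof (rule antisym)
  show "Sup {ennreal \<alpha> |\<alpha>. \<alpha> > 0 \<and> holder_at F x \<alpha>} \<le> ennreal \<beta>"
  proof (rule Sup_least)
    fix y assume "y \<in> {ennreal \<alpha> |\<alpha>. \<alpha> > 0 \<and> holder_at F x \<alpha>}"
    then obtain \<alpha> where \<alpha>: "y = ennreal \<alpha>" "holder_at F x \<alpha>" by blast
    with assms(3) have "\<alpha> \<le> \<beta>" by (meson not_less)
    then show "y \<le> ennreal \<beta>" unfolding \<alpha>(1) by (rule ennreal_leI)
  qed
  show "ennreal \<beta> \<le> Sup {ennreal \<alpha> |\<alpha>. \<alpha> > 0 \<and> holder_at F x \<alpha>}"
    using assms by (intro Sup_upper) auto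
qed

section \<open>Riemann's function near a rational point\<close>

text \<open>
On the two sides of \<open>0\<close> the square root points in the directions \<open>1 - \<i>\<close> and \<open>1 + \<i>\<close>, which are linearly
independent over the reals.
\<close>

lemma csqrt_neg_imaginary:
  "h > 0 \<Longrightarrow> csqrt (- \<i> * of_real h) = of_real (sqrt h) * ((1 - \<i>) / of_real (sqrt 2))"
  "h < 0 \<Longrightarrow> csqrt (- \<i> * of_real h) = of_real (sqrt (- h)) * ((1 + \<i>) / of_real (sqrt 2))"
proof -
  have s2: "(of_real (sqrt 2) :: complex)\<^sup>2 = 2" by (simp flip: of_real_power)
  show "csqrt (- \<i> * of_real h) = of_real (sqrt h) * ((1 - \<i>) / of_real (sqrt 2))" if "h > 0"
  proof (rule csqrt_unique)
    have "(of_real (sqrt h) :: complex)\<^sup>2 = of_real h" using that by (simp flip: of_real_power)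
    then show "(of_real (sqrt h) * ((1 - \<i>) / of_real (sqrt 2)))\<^sup>2 = - \<i> * of_real h"
      unfolding power_mult_distrib power_divide s2 by (simp add: power2_eq_square algebra_simps)
  qed (use that in simp)
  show "csqrt (- \<i> * of_real h) = of_real (sqrt (- h)) * ((1 + \<i>) / of_real (sqrt 2))" if "h < 0"
  proof (rule csqrt_unique)
    have "(of_real (sqrt (- h)) :: complex)\<^sup>2 = - of_real h" using that by (simp flip: of_real_power)
    then show "(of_real (sqrt (- h)) * ((1 + \<i>) / of_real (sqrt 2)))\<^sup>2 = - \<i> * of_real h"
      unfolding power_mult_distrib power_divide s2 by (simp add: power2_eq_square algebra_simps)
  qed (use that in simp)
qed

text \<open>
The coefficients \<open>c\<close> below have period \<open>2 q\<close>. The modulus \<open>2 q\<close> is used for all parities of \<open>p\<close> and \<open>q\<close>,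
so that a single computation of the Gauss sum distinguishes the cases.
\<close>

locale rational_point =
  fixes p q :: int
  assumes q: "q \<ge> 1" and coprime: "coprime p q"
begin

definition r :: real where "r = of_int p / of_int q"

definition c :: "int \<Rightarrow> complex" where "c n = cis (pi * of_int n ^ 2 * r)"

lemma c_add_mult: "c (n + 2 * q * m) = c n"
proof -
  have "pi * (of_int (n + 2 * q * m))\<^sup>2 * r = pi * (of_int n)\<^sup>2 * r + 2 * pi * of_int (p * (2 * n * m + 2 * q * m\<^sup>2))"
    using q by (simp add: r_def field_simps power2_eq_square)
  then have "c (n + 2 * q * m) = c n * cis (2 * pi * of_int (p * (2 * n * m + 2 * q * m\<^sup>2)))"
    by (simp only: c_def cis_mult)
  also have "cis (2 * pi * of_int (p * (2 * n * m + 2 * q * m\<^sup>2))) = 1"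
    by (rule cis_multiple_2pi) (rule Ints_of_int)
  finally show ?thesis by simp
qed

sublocale even_periodic "2 * q" c
proof
  show "c (n mod (2 * q)) = c n" for n
    using c_add_mult[of "n mod (2 * q)" "n div (2 * q)"] by (simp add: mod_mult_div_eq)
qed (use q in \<open>auto simp: c_def\<close>)

lemma c_0: "c 0 = 1" by (simp add: c_def)

lemma c_q: "c q = (if odd p \<and> odd q then -1 else 1)"
proof -
  have "pi * of_int q ^ 2 * r = pi * of_int (p * q)"
    using q by (simp add: r_def power2_eq_square)
  then have "c q = cis (pi * of_int (p * q))" by (simp only: c_def)
  also have "\<dots> = (if even (p * q) then 1 else -1)"
    by (auto simp: complex_eq_iff cos_npi_int sin_npi_int simp del: of_int_mult)
  finally show ?thesis by auto
qed

text \<open>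
Substituting \<open>a + b\<close> for \<open>a\<close> in the double sum of \<open>c a\<close> times the conjugate of \<open>c b\<close> makes the exponent linear in
\<open>b\<close>. The sum over \<open>b\<close> then vanishes unless \<open>q\<close> divides \<open>a\<close>, which leaves \<open>a = 0\<close> and \<open>a = q\<close>.
\<close>

lemma quadratic_gauss_sum_norm_square: "dft 0 * cnj (dft 0) = of_int (2 * q) * (1 + c q)"
proof -
  have G: "dft 0 = (\<Sum>a=0..<2*q. c a)" by (simp add: dft_def)
  have cc: "c (a + b) * cnj (c b) = c a * cis (2 * pi * of_int (b * (2 * a * p)) / of_int (2 * q))" for a b
  proof -
    have "pi * of_int (a + b) ^ 2 * r + - (pi * of_int b ^ 2 * r)
        = pi * of_int a ^ 2 * r + 2 * pi * of_int (b * (2 * a * p)) / of_int (2 * q)"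
      using q by (simp add: r_def field_simps power2_eq_square)
    then show ?thesis unfolding c_def cis_cnj cis_mult by simp
  qed
  have "dft 0 * cnj (dft 0) = (\<Sum>b=0..<2*q. (\<Sum>a=0..<2*q. c a) * cnj (c b))"
    by (simp add: G sum_distrib_left)
  also have "\<dots> = (\<Sum>b=0..<2*q. (\<Sum>a=0..<2*q. c (a + b)) * cnj (c b))"
    by (simp only: sum_period_shift[of "2 * q" c, OF N periodic])
  also have "\<dots> = (\<Sum>a=0..<2*q. \<Sum>b=0..<2*q. c (a + b) * cnj (c b))"
    by (subst sum.swap) (simp add: sum_distrib_right)
  also have "\<dots> = (\<Sum>a=0..<2*q. c a * (\<Sum>b=0..<2*q. cis (2 * pi * of_int (b * (2 * a * p)) / of_int (2 * q))))"
    by (simp only: cc sum_distrib_left)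
  also have "\<dots> = (\<Sum>a=0..<2*q. if q dvd a then of_int (2 * q) * c a else 0)"
  proof (intro sum.cong refl)
    fix a
    have "2 * q dvd 2 * a * p \<longleftrightarrow> q dvd a * p" by (simp add: mult.assoc)
    also have "\<dots> \<longleftrightarrow> q dvd a" using coprime by (simp add: coprime_commute coprime_dvd_mult_left_iff)
    finally show "c a * (\<Sum>b=0..<2*q. cis (2 * pi * of_int (b * (2 * a * p)) / of_int (2 * q)))
        = (if q dvd a then of_int (2 * q) * c a else 0)"
      unfolding sum_roots_of_unity[OF N] by simp
  qed
  also have "\<dots> = (\<Sum>a\<in>{0,q}. of_int (2 * q) * c a)"
  proof (rule sum.mono_neutral_cong_right)
    show "\<forall>a\<in>{0..<2 * q} - {0, q}. (if q dvd a then of_int (2 * q) * c a else 0) = 0"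
    proof
      fix a assume a: "a \<in> {0..<2 * q} - {0, q}"
      have "\<not> q dvd a"
      proof
        assume "q dvd a"
        then obtain k where k: "a = q * k" by auto
        then have "0 \<le> k" "k < 2" using a q by (auto simp: zero_le_mult_iff)
        then have "k = 0 \<or> k = 1" by auto
        with a k show False by auto
      qed
      then show "(if q dvd a then of_int (2 * q) * c a else 0) = 0" by simp
    qed
  qed (use q in auto)
  also have "\<dots> = of_int (2 * q) * (1 + c q)"
    using q by (simp add: c_0 distrib_left)
  finally show ?thesis .
qed

lemma dft_0_eq_0_iff: "dft 0 = 0 \<longleftrightarrow> odd p \<and> odd q"
proof -
  have "dft 0 = 0 \<longleftrightarrow> dft 0 * cnj (dft 0) = 0" by simp
  also have "\<dots> \<longleftrightarrow> odd p \<and> odd q"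
    unfolding quadratic_gauss_sum_norm_square c_q using q by auto
  finally show ?thesis .
qed

text \<open>
Riemann's function as boundary values: multiplying \<open>exp (\<i> \<pi> n\<^sup>2 r)\<close> by \<open>exp (\<i> \<pi> n\<^sup>2 h)\<close> is evaluating the series
at \<open>- \<i> h\<close>.
\<close>

lemma riemann_fun_eq: "riemann_fun (r + h) = pi * Im (square_series 1 c (- \<i> * of_real h))"
proof -
  have "square_term 1 c (- \<i> * of_real h) sums square_series 1 c (- \<i> * of_real h)"
    by (rule square_series_sums_closed[OF bounded]) auto
  then have "(\<lambda>n. pi * Im (square_term 1 c (- \<i> * of_real h) n)) sums (pi * Im (square_series 1 c (- \<i> * of_real h)))"
    by (intro sums_mult sums_Im)
  also have "(\<lambda>n. pi * Im (square_term 1 c (- \<i> * of_real h) n)) = (\<lambda>n. sin (real (Suc n) ^ 2 * pi * (r + h)) / real (Suc n) ^ 2)"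
  proof
    fix n
    have "exp (- of_real (pi * real (Suc n) ^ 2) * (- \<i> * of_real h)) = cis (pi * real (Suc n) ^ 2 * h)"
      unfolding cis_conv_exp by (intro arg_cong[where f = exp]) (simp del: of_nat_Suc)
    then have "square_term 1 c (- \<i> * of_real h) n =
        cis (pi * real (Suc n) ^ 2 * r) * cis (pi * real (Suc n) ^ 2 * h) / of_real (pi * real (Suc n) ^ 2)"
      unfolding square_term_def c_def of_int_of_nat_eq power_one_right by (simp only: times_divide_eq_left)
    also have "cis (pi * real (Suc n) ^ 2 * r) * cis (pi * real (Suc n) ^ 2 * h) = cis (real (Suc n) ^ 2 * pi * (r + h))"
      unfolding cis_mult by (intro arg_cong[where f = cis]) (simp add: algebra_simps del: of_nat_Suc)
    finally show "pi * Im (square_term 1 c (- \<i> * of_real h) n) = sin (real (Suc n) ^ 2 * pi * (r + h)) / real (Suc n) ^ 2"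
      by (simp add: Im_divide_of_real del: of_nat_Suc)
  qed
  finally show ?thesis
    unfolding riemann_fun_def by (simp only: sums_iff)
qed

definition sqrt_part :: "real \<Rightarrow> real" where
  "sqrt_part h = pi / of_int (2 * q) * Im (dft 0 * csqrt (- \<i> * of_real h))"

text \<open>
For positive \<open>h\<close> this is \<open>h \<surd>h\<close> times a periodic function of \<open>1 / h\<close>.
\<close>

definition oscillation :: "real \<Rightarrow> real" where
  "oscillation h = pi * of_int (2 * q) * Im (- \<i> * of_real h * csqrt (- \<i> * of_real h)
      * square_series 1 dft (1 / (of_int (2 * q) ^ 2 * (- \<i> * of_real h))))"

definition expansion_error :: "real \<Rightarrow> real" where
  "expansion_error h = riemann_fun (r + h) - riemann_fun r + pi / 2 * h + sqrt_part h + oscillation h"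

text \<open>
The dual series of index 2, which belongs to the expansion on the half plane, is of the same order as the
remainder and is absorbed into the error.
\<close>

lemma riemann_fun_expansion:
  obtains K where "K \<ge> 0" "\<And>h. h \<noteq> 0 \<Longrightarrow> \<bar>expansion_error h\<bar> \<le> K * \<bar>h\<bar> powr (5/2)"
proof
  define n where "n = real_of_int (2 * q)"
  have n: "n > 0" using q by (simp add: n_def)
  define K where "K = pi * (3 / 2 * n ^ 3 * majorant + 15 / 4 * n ^ 3 * majorant)"
  show "K \<ge> 0" using n majorant_nonneg by (simp add: K_def)
  fix h :: real assume h: "h \<noteq> 0"
  define z where "z = - \<i> * complex_of_real h"
  have z: "0 \<le> Re z" "z \<noteq> 0" "norm z = \<bar>h\<bar>" "Im z = - h" using h by (simp_all add: z_def norm_mult)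
  define E where "E = 3 / 2 * of_real n ^ 3 * (z\<^sup>2 * csqrt z) * square_series 2 dft (1 / (of_int (2 * q) ^ 2 * z))"
  have "square_series 1 c z = square_series 1 c 0 + 1 / 2 * z - dft 0 / of_int (2 * q) * csqrt z
     - of_int (2 * q) * (z * csqrt z) * square_series 1 dft (1 / (of_int (2 * q) ^ 2 * z)) + E + remainder z"
    by (simp add: remainder_def E_def n_def c_0)
  then have "Im (square_series 1 c z) = Im (square_series 1 c 0) - 1 / 2 * h - Im (dft 0 / of_int (2 * q) * csqrt z)
     - Im (of_int (2 * q) * (z * csqrt z * square_series 1 dft (1 / (of_int (2 * q) ^ 2 * z)))) + Im E + Im (remainder z)"
    by (simp add: z(4) mult_ac)
  also have "Im (dft 0 / of_int (2 * q) * csqrt z) = sqrt_part h / pi"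
  proof -
    have "dft 0 / of_int (2 * q) * csqrt z = of_real (1 / n) * (dft 0 * csqrt z)"
      by (simp add: n_def)
    moreover have "Im (of_real (1 / n) * (dft 0 * csqrt z)) = 1 / n * Im (dft 0 * csqrt z)"
      by (simp only: times_complex.sel Im_complex_of_real Re_complex_of_real)
    ultimately show ?thesis
      by (simp add: sqrt_part_def z_def n_def)
  qed
  also have "Im (of_int (2 * q) * (z * csqrt z * square_series 1 dft (1 / (of_int (2 * q) ^ 2 * z)))) = oscillation h / pi"
  proof -
    have "of_int (2 * q) * (z * csqrt z * square_series 1 dft (1 / (of_int (2 * q) ^ 2 * z)))
        = of_real n * (z * csqrt z * square_series 1 dft (1 / (of_int (2 * q) ^ 2 * z)))"
      by (simp add: n_def)
    moreover have "Im (of_real n * X) = n * Im X" for X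
      by (simp only: times_complex.sel Im_complex_of_real Re_complex_of_real)
    ultimately show ?thesis
      by (simp only: oscillation_def z_def n_def) simp
  qed
  finally have eq: "Im (square_series 1 c z) = Im (square_series 1 c 0) - 1 / 2 * h - sqrt_part h / pi - oscillation h / pi + Im E + Im (remainder z)" .
  have "pi * Im (square_series 1 c z) = pi * Im (square_series 1 c 0) - pi / 2 * h - sqrt_part h - oscillation h + pi * (Im E + Im (remainder z))"
    unfolding eq by (simp add: distrib_left right_diff_distrib)
  then have "riemann_fun (r + h) - riemann_fun r + pi / 2 * h + sqrt_part h + oscillation h = pi * (Im E + Im (remainder z))"
    using riemann_fun_eq[of h] riemann_fun_eq[of 0] by (simp add: z_def)
  also have "\<bar>\<dots>\<bar> \<le> pi * (norm E + norm (remainder z))"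
    unfolding abs_mult using abs_Im_le_cmod[of E] abs_Im_le_cmod[of "remainder z"] by simp
  also have "\<dots> \<le> pi * (3 / 2 * n ^ 3 * majorant * (\<bar>h\<bar>\<^sup>2 * sqrt \<bar>h\<bar>) + 15 / 4 * n ^ 3 * majorant * (\<bar>h\<bar>\<^sup>2 * sqrt \<bar>h\<bar>))"
  proof (intro mult_left_mono add_mono)
    have "norm E = 3 / 2 * n ^ 3 * (\<bar>h\<bar>\<^sup>2 * sqrt \<bar>h\<bar>) * norm (square_series 2 dft (1 / (of_int (2 * q) ^ 2 * z)))"
      unfolding E_def norm_mult norm_power norm_csqrt z(3) using n by simp
    also have "\<dots> \<le> 3 / 2 * n ^ 3 * (\<bar>h\<bar>\<^sup>2 * sqrt \<bar>h\<bar>) * majorant"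
      using n z(1) by (intro mult_left_mono norm_square_series_dft_le Re_inverse_nonneg) auto
    finally show "norm E \<le> 3 / 2 * n ^ 3 * majorant * (\<bar>h\<bar>\<^sup>2 * sqrt \<bar>h\<bar>)" by (simp only: mult_ac)
    show "norm (remainder z) \<le> 15 / 4 * n ^ 3 * majorant * (\<bar>h\<bar>\<^sup>2 * sqrt \<bar>h\<bar>)"
      using norm_remainder_le[OF z(1,2)] unfolding z(3) n_def .
  qed simp
  also have "\<dots> = K * (\<bar>h\<bar>\<^sup>2 * sqrt \<bar>h\<bar>)" by (simp add: K_def algebra_simps)
  finally show "\<bar>expansion_error h\<bar> \<le> K * \<bar>h\<bar> powr (5/2)"
    unfolding expansion_error_def sqrt_abs_powr(3) .
qed

lemma abs_sqrt_part_le: "\<bar>sqrt_part h\<bar> \<le> pi / of_int (2 * q) * norm (dft 0) * \<bar>h\<bar> powr (1/2)"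
proof -
  have "\<bar>Im (dft 0 * csqrt (- \<i> * of_real h))\<bar> \<le> norm (dft 0 * csqrt (- \<i> * of_real h))"
    by (rule abs_Im_le_cmod)
  also have "\<dots> = norm (dft 0) * \<bar>h\<bar> powr (1/2)"
    by (simp only: norm_mult norm_csqrt norm_minus_cancel norm_ii norm_of_real mult_1_left sqrt_abs_powr)
  finally have "pi / of_int (2 * q) * \<bar>Im (dft 0 * csqrt (- \<i> * of_real h))\<bar>
      \<le> pi / of_int (2 * q) * (norm (dft 0) * \<bar>h\<bar> powr (1/2))"
    using q by (intro mult_left_mono) auto
  then show ?thesis using q by (simp add: sqrt_part_def abs_mult)
qed

lemma abs_oscillation_le: "\<bar>oscillation h\<bar> \<le> pi * of_int (2 * q) * majorant * \<bar>h\<bar> powr (3/2)"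
proof -
  define L where "L = square_series 1 dft (1 / (of_int (2 * q) ^ 2 * (- \<i> * of_real h)))"
  have "\<bar>Im (- \<i> * of_real h * csqrt (- \<i> * of_real h) * L)\<bar> \<le> norm (- \<i> * of_real h * csqrt (- \<i> * of_real h) * L)"
    by (rule abs_Im_le_cmod)
  also have "\<dots> = \<bar>h\<bar> * sqrt \<bar>h\<bar> * norm L"
    by (simp only: norm_mult norm_csqrt norm_minus_cancel norm_ii norm_of_real mult_1_left)
  also have "\<dots> \<le> \<bar>h\<bar> * sqrt \<bar>h\<bar> * majorant"
    unfolding L_def by (intro mult_left_mono norm_square_series_dft_le Re_inverse_nonneg) auto
  finally have "pi * of_int (2 * q) * \<bar>Im (- \<i> * of_real h * csqrt (- \<i> * of_real h) * L)\<bar>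
      \<le> pi * of_int (2 * q) * (\<bar>h\<bar> powr (3/2) * majorant)"
    using q unfolding sqrt_abs_powr(2) by (intro mult_left_mono) auto
  moreover have "\<bar>oscillation h\<bar> = pi * of_int (2 * q) * \<bar>Im (- \<i> * of_real h * csqrt (- \<i> * of_real h) * L)\<bar>"
    unfolding oscillation_def L_def[symmetric] abs_mult[of "pi * of_int (2 * q)"] using q by simp
  ultimately show ?thesis by (simp only: mult_ac)
qed

lemma holder_at_half: "holder_at riemann_fun r (1/2)"
proof -
  obtain K where K: "K \<ge> 0" "\<And>h. h \<noteq> 0 \<Longrightarrow> \<bar>expansion_error h\<bar> \<le> K * \<bar>h\<bar> powr (5/2)"
    using riemann_fun_expansion by blast
  define M1 M2 where "M1 = pi / of_int (2 * q) * norm (dft 0)" and "M2 = pi * of_int (2 * q) * majorant"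
  have M: "M1 \<ge> 0" "M2 \<ge> 0" using q majorant_nonneg by (auto simp: M1_def M2_def)
  show ?thesis
  proof (rule holder_at_linear_approxI[where a = 0 and K = "K + M1 + M2 + pi / 2"])
    show "\<forall>\<^sub>F h in at 0. \<bar>riemann_fun (r + h) - riemann_fun r - 0 * h\<bar> \<le> (K + M1 + M2 + pi / 2) * \<bar>h\<bar> powr (1/2)"
      using eventually_abs_le_1
    proof eventually_elim
      case (elim h)
      have "\<bar>expansion_error h\<bar> \<le> K * \<bar>h\<bar> powr (1/2)"
        using elim K(1) by (intro order_trans[OF K(2)] mult_left_mono powr_mono_near_0) auto
      moreover have "\<bar>sqrt_part h\<bar> \<le> M1 * \<bar>h\<bar> powr (1/2)"
        using abs_sqrt_part_le by (simp add: M1_def)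
      moreover have "\<bar>oscillation h\<bar> \<le> M2 * \<bar>h\<bar> powr (1/2)"
        using elim M unfolding M2_def by (intro order_trans[OF abs_oscillation_le] mult_left_mono powr_mono_near_0) auto
      moreover have "\<bar>pi / 2 * h\<bar> \<le> pi / 2 * \<bar>h\<bar> powr (1/2)"
        using elim powr_mono_near_0[of h "1/2" 1] by (simp add: abs_mult)
      moreover have "riemann_fun (r + h) - riemann_fun r - 0 * h = expansion_error h - sqrt_part h - oscillation h - pi / 2 * h"
        by (simp add: expansion_error_def)
      ultimately show ?case unfolding distrib_right by linarith
    qed
  qed
qed

lemma abs_riemann_fun_linear_approx:
  assumes "dft 0 = 0"
  obtains K where "\<And>h. \<bar>h\<bar> \<le> 1 \<Longrightarrow> h \<noteq> 0 \<Longrightarrow> \<bar>riemann_fun (r + h) - riemann_fun r - (- pi / 2) * h\<bar> \<le> K * \<bar>h\<bar> powr (3/2)"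
proof -
  obtain K where K: "K \<ge> 0" "\<And>h. h \<noteq> 0 \<Longrightarrow> \<bar>expansion_error h\<bar> \<le> K * \<bar>h\<bar> powr (5/2)"
    using riemann_fun_expansion by blast
  have "\<bar>riemann_fun (r + h) - riemann_fun r - (- pi / 2) * h\<bar> \<le> (K + pi * of_int (2 * q) * majorant) * \<bar>h\<bar> powr (3/2)"
    if "\<bar>h\<bar> \<le> 1" "h \<noteq> 0" for h
  proof -
    have "\<bar>expansion_error h\<bar> \<le> K * \<bar>h\<bar> powr (3/2)"
      using that K(1) by (intro order_trans[OF K(2)] mult_left_mono powr_mono_near_0) auto
    moreover have "riemann_fun (r + h) - riemann_fun r - (- pi / 2) * h = expansion_error h - oscillation h"
      using assms by (simp add: expansion_error_def sqrt_part_def)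
    ultimately show ?thesis unfolding distrib_right using abs_oscillation_le[of h] by linarith
  qed
  then show ?thesis by (rule that)
qed

lemma holder_at_three_halves:
  assumes "dft 0 = 0"
  shows "holder_at riemann_fun r (3/2)"
proof -
  obtain K where K: "\<And>h. \<bar>h\<bar> \<le> 1 \<Longrightarrow> h \<noteq> 0 \<Longrightarrow> \<bar>riemann_fun (r + h) - riemann_fun r - (- pi / 2) * h\<bar> \<le> K * \<bar>h\<bar> powr (3/2)"
    using abs_riemann_fun_linear_approx[OF assms] by blast
  show ?thesis
  proof (rule holder_at_linear_approxI)
    show "\<forall>\<^sub>F h in at 0. \<bar>riemann_fun (r + h) - riemann_fun r - (- pi / 2) * h\<bar> \<le> K * \<bar>h\<bar> powr (3/2)"
      using eventually_abs_le_1 by eventually_elim (intro K; simp)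
  qed
qed

lemma riemann_fun_linear_approx_tendsto:
  assumes "dft 0 = 0"
  shows "((\<lambda>h. (riemann_fun (r + h) - riemann_fun r - (- pi / 2) * h) / \<bar>h\<bar> powr 1) \<longlongrightarrow> 0) (at 0)"
proof -
  obtain K where K: "\<And>h. \<bar>h\<bar> \<le> 1 \<Longrightarrow> h \<noteq> 0 \<Longrightarrow> \<bar>riemann_fun (r + h) - riemann_fun r - (- pi / 2) * h\<bar> \<le> K * \<bar>h\<bar> powr (3/2)"
    using abs_riemann_fun_linear_approx[OF assms] by blast
  define g where "g = (\<lambda>h. if \<bar>h\<bar> \<le> 1 then riemann_fun (r + h) - riemann_fun r - (- pi / 2) * h else 0)"
  have "((\<lambda>h. g h / \<bar>h\<bar> powr 1) \<longlongrightarrow> 0) (at 0)"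
  proof (rule tendsto_quotient_powr)
    have "0 \<le> K" using K[of 1] by (auto intro: order_trans[OF abs_ge_zero])
    then show "\<bar>g h\<bar> \<le> K * \<bar>h\<bar> powr (3/2)" if "h \<noteq> 0" for h
      using K[OF _ that] by (simp add: g_def)
  qed simp
  then show ?thesis
    by (rule Lim_transform_eventually) (use eventually_abs_le_1 in \<open>eventually_elim, simp add: g_def\<close>)
qed

lemma riemann_fun_differentiable:
  assumes "dft 0 = 0"
  shows "riemann_fun differentiable (at r)"
proof -
  have "((\<lambda>h. (riemann_fun (r + h) - riemann_fun r - (- pi / 2) * h) / h) \<longlongrightarrow> 0) (at 0)"
    by (rule tendsto_rabs_zero_cancel)
       (use tendsto_rabs_zero[OF riemann_fun_linear_approx_tendsto[OF assms]] in \<open>simp add: abs_divide\<close>)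
  then have "((\<lambda>h. (riemann_fun (r + h) - riemann_fun r) / h - (- pi / 2)) \<longlongrightarrow> 0) (at 0)"
    by (rule Lim_transform_eventually) (auto simp: eventually_at_filter field_simps)
  then have "(riemann_fun has_field_derivative (- pi / 2)) (at r)"
    unfolding DERIV_def by (rule LIM_zero_cancel)
  then show ?thesis by (auto simp: real_differentiable_def)
qed

text \<open>
A larger exponent makes the increment, less a linear term, \<open>o(\<surd>|h|)\<close>. As the linear term is itself of
that order, the square root part would be too. But divided by \<open>\<surd>|h|\<close> it is constant on either
side of \<open>0\<close>, and the two constants vanish together only if \<open>dft 0 = 0\<close>.
\<close>

lemma not_holder_at_half:
  assumes G: "dft 0 \<noteq> 0" and \<alpha>: "\<alpha> > 1/2"
  shows "\<not> holder_at riemann_fun r \<alpha>"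
proof
  assume "holder_at riemann_fun r \<alpha>"
  then obtain a where a: "((\<lambda>h. (riemann_fun (r + h) - riemann_fun r - a * h) / \<bar>h\<bar> powr (1/2)) \<longlongrightarrow> 0) (at 0)"
    using holder_at_imp_linear_approx[of riemann_fun r \<alpha> "1/2"] \<alpha> by auto
  obtain K where K: "K \<ge> 0" "\<And>h. h \<noteq> 0 \<Longrightarrow> \<bar>expansion_error h\<bar> \<le> K * \<bar>h\<bar> powr (5/2)"
    using riemann_fun_expansion by blast
  have lin: "((\<lambda>h::real. (a + pi / 2) * h / \<bar>h\<bar> powr (1/2)) \<longlongrightarrow> 0) (at 0)"
    by (rule tendsto_quotient_powr[where \<gamma> = 1 and K = "\<bar>a + pi / 2\<bar>"]) (simp_all add: abs_mult)
  have osc: "((\<lambda>h. oscillation h / \<bar>h\<bar> powr (1/2)) \<longlongrightarrow> 0) (at 0)"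
    by (rule tendsto_quotient_powr[OF abs_oscillation_le]) simp
  have err: "((\<lambda>h. expansion_error h / \<bar>h\<bar> powr (1/2)) \<longlongrightarrow> 0) (at 0)"
    by (rule tendsto_quotient_powr[OF K(2)]) simp_all
  have "((\<lambda>h. expansion_error h / \<bar>h\<bar> powr (1/2) - oscillation h / \<bar>h\<bar> powr (1/2) - (a + pi / 2) * h / \<bar>h\<bar> powr (1/2)
      - (riemann_fun (r + h) - riemann_fun r - a * h) / \<bar>h\<bar> powr (1/2)) \<longlongrightarrow> 0 - 0 - 0 - 0) (at 0)"
    by (intro tendsto_diff lin osc err a)
  also have "(\<lambda>h. expansion_error h / \<bar>h\<bar> powr (1/2) - oscillation h / \<bar>h\<bar> powr (1/2) - (a + pi / 2) * h / \<bar>h\<bar> powr (1/2)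
      - (riemann_fun (r + h) - riemann_fun r - a * h) / \<bar>h\<bar> powr (1/2)) = (\<lambda>h. sqrt_part h / sqrt \<bar>h\<bar>)"
    by (simp add: expansion_error_def sqrt_abs_powr algebra_simps flip: diff_divide_distrib add_divide_distrib)
  finally have lim: "((\<lambda>h. sqrt_part h / sqrt \<bar>h\<bar>) \<longlongrightarrow> 0) (at 0)" by simp
  define C where "C = pi / of_int (2 * q)"
  have C: "C > 0" using q by (simp add: C_def)
  have right: "sqrt_part h / sqrt \<bar>h\<bar> = C * Im (dft 0 * ((1 - \<i>) / of_real (sqrt 2)))" if "h > 0" for h
    using that unfolding sqrt_part_def csqrt_neg_imaginary(1)[OF that] C_def[symmetric] mult.left_commute[of "dft 0"]
      Im_complex_of_real Re_complex_of_real times_complex.sel(2)[of "of_real _"] by simp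
  have left: "sqrt_part h / sqrt \<bar>h\<bar> = C * Im (dft 0 * ((1 + \<i>) / of_real (sqrt 2)))" if "h < 0" for h
    using that unfolding sqrt_part_def csqrt_neg_imaginary(2)[OF that] C_def[symmetric] mult.left_commute[of "dft 0"]
      Im_complex_of_real Re_complex_of_real times_complex.sel(2)[of "of_real _"] by simp
  have "((\<lambda>h. sqrt_part h / sqrt \<bar>h\<bar>) \<longlongrightarrow> C * Im (dft 0 * ((1 - \<i>) / of_real (sqrt 2)))) (at_right 0)"
    by (rule tendsto_eventually, unfold eventually_at_filter, intro always_eventually allI impI right) simp
  then have R: "C * Im (dft 0 * ((1 - \<i>) / of_real (sqrt 2))) = 0"
    using tendsto_unique[OF _ _ tendsto_mono[OF at_le lim]] trivial_limit_at_right_real by blast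
  have "((\<lambda>h. sqrt_part h / sqrt \<bar>h\<bar>) \<longlongrightarrow> C * Im (dft 0 * ((1 + \<i>) / of_real (sqrt 2)))) (at_left 0)"
    by (rule tendsto_eventually, unfold eventually_at_filter, intro always_eventually allI impI left) simp
  then have L: "C * Im (dft 0 * ((1 + \<i>) / of_real (sqrt 2))) = 0"
    using tendsto_unique[OF _ _ tendsto_mono[OF at_le lim]] trivial_limit_at_left_real by blast
  have "Im (dft 0) - Re (dft 0) = 0" "Im (dft 0) + Re (dft 0) = 0"
    using R L C by (simp_all add: field_simps)
  then have "dft 0 = 0" by (simp add: complex_eq_iff)
  with G show False by simp
qed

text \<open>
A larger exponent makes the increment, less a linear term, \<open>o(|h| powr (3/2))\<close>. The linear term can only be
the derivative, so the oscillating term is of that order too. After division by \<open>h \<surd>h\<close> it is periodic in \<open>1 / h\<close>, so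
it vanishes identically for \<open>h > 0\<close>, and then so do all values of the discrete Fourier transform.
\<close>

lemma not_holder_at_three_halves:
  assumes G: "dft 0 = 0" and \<alpha>: "\<alpha> > 3/2"
  shows "\<not> holder_at riemann_fun r \<alpha>"
proof
  interpret dft: even_periodic "2 * q" dft by (rule even_periodic_dft)
  assume "holder_at riemann_fun r \<alpha>"
  then obtain a where a: "((\<lambda>h. (riemann_fun (r + h) - riemann_fun r - a * h) / \<bar>h\<bar> powr (3/2)) \<longlongrightarrow> 0) (at 0)"
    using holder_at_imp_linear_approx[of riemann_fun r \<alpha> "3/2"] \<alpha> by auto
  obtain K where K: "K \<ge> 0" "\<And>h. h \<noteq> 0 \<Longrightarrow> \<bar>expansion_error h\<bar> \<le> K * \<bar>h\<bar> powr (5/2)"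
    using riemann_fun_expansion by blast
  have "((\<lambda>h. (riemann_fun (r + h) - riemann_fun r - a * h) / \<bar>h\<bar> powr (3/2) * \<bar>h\<bar> powr (1/2)) \<longlongrightarrow> 0 * 0) (at 0)"
    by (intro tendsto_mult a tendsto_abs_powr_0) simp
  moreover have "x / \<bar>h\<bar> powr (3/2) * \<bar>h\<bar> powr (1/2) = x / \<bar>h\<bar> powr 1" for x h :: real
  proof -
    have "\<bar>h\<bar> powr (3/2) = \<bar>h\<bar> powr 1 * \<bar>h\<bar> powr (1/2)" by (subst powr_add[symmetric]) simp
    then show ?thesis by (cases "h = 0") simp_all
  qed
  ultimately have "((\<lambda>h. (riemann_fun (r + h) - riemann_fun r - a * h) / \<bar>h\<bar> powr 1) \<longlongrightarrow> 0) (at 0)"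
    by (simp only: mult_zero_left)
  from tendsto_diff[OF riemann_fun_linear_approx_tendsto[OF G] this]
  have "((\<lambda>h. (a + pi / 2) * h / \<bar>h\<bar>) \<longlongrightarrow> 0) (at 0)"
    by (simp add: algebra_simps flip: diff_divide_distrib)
  then have "((\<lambda>h. (a + pi / 2) * h / \<bar>h\<bar>) \<longlongrightarrow> 0) (at_right 0)"
    by (rule tendsto_mono[OF at_le, rotated]) simp
  moreover have "((\<lambda>h. (a + pi / 2) * h / \<bar>h\<bar>) \<longlongrightarrow> a + pi / 2) (at_right 0)"
    by (rule tendsto_eventually) (auto simp: eventually_at_filter)
  ultimately have a_eq: "a = - pi / 2"
    using tendsto_unique[OF trivial_limit_at_right_real] by fastforce
  have err: "((\<lambda>h. expansion_error h / \<bar>h\<bar> powr (3/2)) \<longlongrightarrow> 0) (at 0)"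
    by (rule tendsto_quotient_powr[OF K(2)]) simp_all
  have "((\<lambda>h. expansion_error h / \<bar>h\<bar> powr (3/2) - (riemann_fun (r + h) - riemann_fun r - a * h) / \<bar>h\<bar> powr (3/2)) \<longlongrightarrow> 0 - 0) (at 0)"
    by (intro tendsto_diff err a)
  moreover have "expansion_error h / \<bar>h\<bar> powr (3/2) - (riemann_fun (r + h) - riemann_fun r - a * h) / \<bar>h\<bar> powr (3/2)
      = oscillation h / \<bar>h\<bar> powr (3/2)" for h
    unfolding diff_divide_distrib[symmetric] a_eq by (simp add: expansion_error_def sqrt_part_def G)
  ultimately have lim: "((\<lambda>h. oscillation h / \<bar>h\<bar> powr (3/2)) \<longlongrightarrow> 0) (at 0)" by simp
  define n where "n = real_of_int (2 * q)"
  have n: "n > 0" using q by (simp add: n_def)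
  \<comment> \<open>This is \<open>z \<surd>z / (h \<surd>h)\<close> for \<open>z = - \<i> h\<close> with \<open>h > 0\<close>.\<close>
  define \<omega> where "\<omega> = - \<i> * ((1 - \<i>) / of_real (sqrt 2))"
  have om: "\<omega> \<noteq> 0" by (simp add: \<omega>_def complex_eq_iff)
  define \<psi> where "\<psi> = (\<lambda>u::real. Im (\<omega> * square_series 1 dft (\<i> * of_real u)))"
  have osc: "oscillation (1 / (n\<^sup>2 * u)) / \<bar>1 / (n\<^sup>2 * u)\<bar> powr (3/2) = pi * n * \<psi> u" if u: "u > 0" for u
  proof -
    define h where "h = 1 / (n\<^sup>2 * u)"
    have h: "h > 0" using n u by (simp add: h_def)
    have "n\<^sup>2 * u * h = 1" using n u by (simp add: h_def)
    then have "of_real (n\<^sup>2 * u * h) = (1::complex)" by simp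
    then have "(of_int (2 * q) ^ 2 * (- \<i> * of_real h)) * (\<i> * of_real u) = 1"
      by (simp add: n_def mult_ac)
    then have w: "1 / (of_int (2 * q) ^ 2 * (- \<i> * of_real h)) = \<i> * of_real u"
      unfolding divide_inverse mult_1_left by (rule inverse_unique)
    have "- \<i> * of_real h * csqrt (- \<i> * of_real h) * square_series 1 dft (\<i> * of_real u)
        = of_real (h * sqrt h) * (\<omega> * square_series 1 dft (\<i> * of_real u))"
      unfolding csqrt_neg_imaginary(1)[OF h] \<omega>_def by simp
    then have "oscillation h = pi * n * (h * sqrt h * \<psi> u)"
      unfolding oscillation_def w \<psi>_def n_def by (simp only: times_complex.sel Re_complex_of_real Im_complex_of_real) simp
    moreover have "\<bar>h\<bar> powr (3/2) = h * sqrt h" using sqrt_abs_powr(2)[of h] h by simp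
    ultimately show ?thesis using h unfolding h_def[symmetric] by simp
  qed
  \<comment> \<open>By periodicity \<open>\<psi> u\<close> is the value at all \<open>u + 2 k\<close>, and these correspond to \<open>h\<close> tending to \<open>0\<close>.\<close>
  have psi: "\<psi> u = 0" for u
  proof -
    have "filterlim (\<lambda>k::nat. u + 2 * real k) at_top sequentially"
      by (intro filterlim_tendsto_add_at_top[OF tendsto_const] filterlim_tendsto_pos_mult_at_top[OF tendsto_const]
          filterlim_real_sequentially) simp
    note base = this
    have top: "filterlim (\<lambda>k::nat. n\<^sup>2 * (u + 2 * real k)) at_top sequentially"
      using n by (intro filterlim_tendsto_pos_mult_at_top[OF tendsto_const _ base]) simp
    have ev: "\<forall>\<^sub>F k in sequentially. u + 2 * real k > 0"
      using base by (simp add: filterlim_at_top_dense)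
    have "((\<lambda>k::nat. 1 / (n\<^sup>2 * (u + 2 * real k))) \<longlongrightarrow> 0) sequentially"
      by (rule tendsto_divide_0[OF tendsto_const filterlim_at_top_imp_at_infinity[OF top]])
    then have "filterlim (\<lambda>k::nat. 1 / (n\<^sup>2 * (u + 2 * real k))) (at 0) sequentially"
      unfolding filterlim_at using ev n by (auto elim!: eventually_mono)
    from filterlim_compose[OF lim this]
    have "((\<lambda>k. oscillation (1 / (n\<^sup>2 * (u + 2 * real k))) / \<bar>1 / (n\<^sup>2 * (u + 2 * real k))\<bar> powr (3/2)) \<longlongrightarrow> 0) sequentially" .
    moreover have per: "\<psi> (u + 2 * real k) = \<psi> u" for k
      using square_series_periodic[of dft _ 1 "\<i> * of_real u" k, OF dft.bounded]
      unfolding \<psi>_def by (simp add: algebra_simps)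
    from ev have "\<forall>\<^sub>F k in sequentially. oscillation (1 / (n\<^sup>2 * (u + 2 * real k))) / \<bar>1 / (n\<^sup>2 * (u + 2 * real k))\<bar> powr (3/2) = pi * n * \<psi> u"
      by eventually_elim (simp only: osc per)
    then have "((\<lambda>k. oscillation (1 / (n\<^sup>2 * (u + 2 * real k))) / \<bar>1 / (n\<^sup>2 * (u + 2 * real k))\<bar> powr (3/2)) \<longlongrightarrow> pi * n * \<psi> u) sequentially"
      by (rule tendsto_eventually)
    ultimately have "pi * n * \<psi> u = 0" using LIMSEQ_unique by blast
    then show ?thesis using n by simp
  qed
  have zero: "dft (int (Suc m)) = 0" for m
    by (rule square_series_real_on_imaginary_axis_imp_zero[OF dft.bounded order_refl om]) (use psi in \<open>simp add: \<psi>_def\<close>)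
  have "dft k = 0" if "k \<in> {0..<2*q}" for k
    using zero[of "nat (k - 1)"] G that by (cases "k = 0") auto
  then have "(\<Sum>k=0..<2*q. dft k) = 0" by simp
  then show False using sum_dft q by (simp add: c_0)
qed

end

theorem corollary3p3:
  fixes p q :: int and r :: real
  assumes "r = of_int p / of_int q" and "q \<ge> 1" and "coprime p q"
  shows "(odd p \<and> odd q \<longrightarrow>
            riemann_fun differentiable (at r) \<and> holder_exponent riemann_fun r = ennreal (3/2)) \<and>
         (\<not> (odd p \<and> odd q) \<longrightarrow> holder_exponent riemann_fun r = ennreal (1/2))"
proof -
  interpret rational_point p q by standard (rule assms)+
  have r: "r = rational_point.r p q" using assms(1) by (simp add: r_def)
  show ?thesis
    unfolding r dft_0_eq_0_iff[symmetric]
    by (intro conjI impI riemann_fun_differentiable holder_exponent_eqI holder_at_three_halves holder_at_half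
        not_holder_at_half not_holder_at_three_halves) auto
qed

end
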